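(* Let $n\ge 2$, $t\ge 3$, let $\Sigma^*=PG(V,\mathbb{F}_{q^t})=PG(tn-1,q^t)$, let $\Psi$ be a semilinear collineation of $\Sigma^*$ of order $t$ whose set of fixed points $\Sigma$ is a subgeometry isomorphic to $PG(tn-1,q)$, let $\mathcal D$ be a Desarguesian $(t-1)$-spread of $\Sigma$ and let $\Theta$ be a director space of $\mathcal D$. Let $i_1,i_2\in\{0,1,\dots,t-1\}$ with $\gcd(i_2-i_1,t)=1$, and put $\Gamma=\langle\Theta^{\Psi^i}: i\in\{0,\dots,t-1\}\setminus\{i_1,i_2\}\rangle_{q^t}$ and $\Lambda=\langle\Theta^{\Psi^{i_1}},\Theta^{\Psi^{i_2}}\rangle_{q^t}$. Then $\Gamma$ is an $(n(t-2)-1)$-dimensional subspace disjoint from $\Sigma$ and from $\Lambda$, $\Lambda$ has dimension $2n-1$, and the projection $p_{\Gamma,\Lambda}(\Sigma)$ is a scattered $\mathbb{F}_q$-linear set of $\Lambda$ of rank $tn$ of type $L_{\rho,f}$; in particular it is of pseudoregulus type with transversal spaces $\Theta^{\Psi^{i_1}}$ and $\Theta^{\Psi^{i_2}}$.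
   Context: Director spaces / Desarguesian spreads: if $\Theta$ is an $(n-1)$-dimensional subspace of $\Sigma^*$ such that $\Theta,\Theta^\Psi,\dots,\Theta^{\Psi^{t-1}}$ span $\Sigma^*$, then $\mathcal D(\Theta)=\{\langle P,P^\Psi,\dots,P^{\Psi^{t-1}}\rangle_{q^t}\cap\Sigma: P\in\Theta\}$ is a $(t-1)$-spread of $\Sigma$ (a partition of the points of $\Sigma$ into $(t-1)$-dimensional subspaces), called Desarguesian; a Desarguesian spread $\mathcal D$ of $\Sigma$ is one of the form $\mathcal D(\Theta)$, and the subspaces $\Theta^{\Psi^i}$, $i=0,\dots,t-1$, are its director spaces. Projection: if $\Gamma$ is a subspace of $\Sigma^*$ disjoint from $\Sigma$ and $\Lambda$ a subspace disjoint from $\Gamma$ with $\dim\Gamma+\dim\Lambda=\dim\Sigma^*-1$, then $p_{\Gamma,\Lambda}(\Sigma)=\{\langle\Gamma,P\rangle_{q^t}\cap\Lambda: P\in\Sigma\}$. Type $L_{\rho,f}$: writing $\Lambda=PG(V',\mathbb{F}_{q^t})$, a linear set of type $L_{\rho,f}$ is $\{\langle\mathbf u+\rho f(\mathbf u)\rangle_{q^t}:\mathbf u\in U_1\setminus\{\mathbf 0\}\}$ for some decomposition $V'=U_1\oplus U_2$ with $\dim U_1=\dim U_2=n$, some invertible semilinear $f:U_1\to U_2$ whose companion automorphism $\sigma$ satisfies $\mathrm{Fix}(\sigma)=\mathbb{F}_q$, and some $\rho\in\mathbb{F}_{q^t}^*$; its transversal spaces are $PG(U_1,\mathbb{F}_{q^t})$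 and $PG(U_2,\mathbb{F}_{q^t})$. A linear set $L_U$ ($U$ an $\mathbb F_q$-subspace) is scattered if $\dim_{\mathbb F_q}(U\cap\langle\mathbf u\rangle_{q^t})=1$ for all nonzero $\mathbf u\in U$. Pseudoregulus type: for $t,n\ge2$, a scattered $\mathbb{F}_q$-linear set $L$ of $PG(2n-1,q^t)$ of rank $tn$ such that (i) there are $(q^{nt}-1)/(q^t-1)$ pairwise disjoint lines each meeting $L$ in a linear set of rank $t$, and (ii) there are exactly two $(n-1)$-dimensional subspaces (transversal spaces) disjoint from $L$ meeting all these lines. *)

theory Defs
  imports Main "HOL-Library.Function_Algebras"
begin

text \<open>Vectors of V = F_{q^t}^N are modelled as functions nat => 'k vanishing from index N on.
 Projective subspaces are represented by the underlying vector subspaces (sets of vectors);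
 a point is a 1-dimensional subspace.\<close>

type_synonym 'k vect = "nat \<Rightarrow> 'k"

definition vecs :: "nat \<Rightarrow> 'k::zero vect set" where
  "vecs N = {v. \<forall>i\<ge>N. v i = 0}"

definition sc :: "'k::times \<Rightarrow> 'k vect \<Rightarrow> 'k vect" where
  "sc c v = (\<lambda>i. c * v i)"

definition lspan :: "'k::field set \<Rightarrow> 'k vect set \<Rightarrow> 'k vect set" where
  "lspan C S = {v. \<exists>F c. finite F \<and> F \<subseteq> S \<and> (\<forall>x\<in>F. c x \<in> C) \<and> v = (\<Sum>x\<in>F. sc (c x) x)}"

abbreviation kspan :: "'k::field vect set \<Rightarrow> 'k vect set" where
  "kspan S \<equiv> lspan UNIV S"

definition ldim :: "'k::field set \<Rightarrow> 'k vect set \<Rightarrow> nat" where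
  "ldim C W = (LEAST k. \<exists>B. finite B \<and> card B = k \<and> lspan C B = W)"

abbreviation kdim :: "'k::field vect set \<Rightarrow> nat" where
  "kdim W \<equiv> ldim UNIV W"

definition Fq :: "nat \<Rightarrow> 'k::field set" where
  "Fq q = {x. x ^ q = x}"

definition fqdim :: "nat \<Rightarrow> 'k::field vect set \<Rightarrow> nat" where
  "fqdim q W = ldim (Fq q) W"

definition ksub :: "nat \<Rightarrow> 'k::field vect set \<Rightarrow> bool" where
  "ksub N W \<longleftrightarrow> W \<subseteq> vecs N \<and> kspan W = W"

definition fqsub :: "nat \<Rightarrow> 'k::field vect set \<Rightarrow> bool" where
  "fqsub q U \<longleftrightarrow> 0 \<in> U \<and> (\<forall>u\<in>U. \<forall>v\<in>U. u + v \<in> U) \<and> (\<forall>c\<in>Fq q. \<forall>u\<in>U. sc c u \<in> U)"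

definition points :: "nat \<Rightarrow> 'k::field vect set set" where
  "points N = {kspan {v} | v. v \<in> vecs N \<and> v \<noteq> 0}"

definition field_aut :: "('k::field \<Rightarrow> 'k) \<Rightarrow> bool" where
  "field_aut \<sigma> \<longleftrightarrow> bij \<sigma> \<and> (\<forall>x y. \<sigma> (x + y) = \<sigma> x + \<sigma> y) \<and> (\<forall>x y. \<sigma> (x * y) = \<sigma> x * \<sigma> y)"

definition semilinear_on :: "'k::field vect set \<Rightarrow> 'k vect set \<Rightarrow> ('k vect \<Rightarrow> 'k vect) \<Rightarrow> ('k \<Rightarrow> 'k) \<Rightarrow> bool" where
  "semilinear_on A B f \<sigma> \<longleftrightarrow> field_aut \<sigma> \<and> bij_betw f A B \<and>
     (\<forall>u\<in>A. \<forall>v\<in>A. f (u + v) = f u + f v) \<and> (\<forall>c. \<forall>v\<in>A. f (sc c v) = sc (\<sigma> c) (f v))"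

definition coll_order :: "nat \<Rightarrow> ('k::field vect \<Rightarrow> 'k vect) \<Rightarrow> nat \<Rightarrow> bool" where
  "coll_order N \<phi> t \<longleftrightarrow> (\<forall>P\<in>points N. (\<phi> ^^ t) ` P = P) \<and>
     (\<forall>j. 0 < j \<and> j < t \<longrightarrow> (\<exists>P\<in>points N. (\<phi> ^^ j) ` P \<noteq> P))"

definition fixpts :: "nat \<Rightarrow> ('k::field vect \<Rightarrow> 'k vect) \<Rightarrow> 'k vect set set" where
  "fixpts N \<phi> = {P \<in> points N. \<phi> ` P = P}"

definition canonical_subgeometry :: "nat \<Rightarrow> nat \<Rightarrow> 'k::field vect set set \<Rightarrow> bool" where
  "canonical_subgeometry q N S \<longleftrightarrow> (\<exists>b :: nat \<Rightarrow> 'k vect.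
     (\<forall>i<N. b i \<in> vecs N) \<and>
     (\<forall>c. (\<Sum>i<N. sc (c i) (b i)) = 0 \<longrightarrow> (\<forall>i<N. c i = 0)) \<and>
     kspan (b ` {..<N}) = vecs N \<and>
     S = {kspan {\<Sum>i<N. sc (a i) (b i)} | a. (\<forall>i<N. a i \<in> Fq q) \<and> (\<exists>i<N. a i \<noteq> 0)})"

definition director_cond :: "nat \<Rightarrow> nat \<Rightarrow> nat \<Rightarrow> ('k::field vect \<Rightarrow> 'k vect) \<Rightarrow> 'k vect set \<Rightarrow> bool" where
  "director_cond N t n \<phi> \<Theta> \<longleftrightarrow> ksub N \<Theta> \<and> kdim \<Theta> = n \<and>
     kspan (\<Union>i<t. (\<phi> ^^ i) ` \<Theta>) = vecs N"

definition Dsp :: "nat \<Rightarrow> nat \<Rightarrow> ('k::field vect \<Rightarrow> 'k vect) \<Rightarrow> 'k vect set \<Rightarrow> 'k vect set set set" where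
  "Dsp N t \<phi> \<Theta> = {{Q \<in> fixpts N \<phi>. Q \<subseteq> kspan (\<Union>j<t. (\<phi> ^^ j) ` P)} | P. P \<in> points N \<and> P \<subseteq> \<Theta>}"

definition desarguesian_spread :: "nat \<Rightarrow> nat \<Rightarrow> nat \<Rightarrow> ('k::field vect \<Rightarrow> 'k vect) \<Rightarrow> 'k vect set set set \<Rightarrow> bool" where
  "desarguesian_spread N t n \<phi> D \<longleftrightarrow> (\<exists>\<Theta>. director_cond N t n \<phi> \<Theta> \<and> D = Dsp N t \<phi> \<Theta>)"

definition director_space :: "nat \<Rightarrow> nat \<Rightarrow> nat \<Rightarrow> ('k::field vect \<Rightarrow> 'k vect) \<Rightarrow> 'k vect set set set \<Rightarrow> 'k vect set \<Rightarrow> bool" where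
  "director_space N t n \<phi> D \<Theta> \<longleftrightarrow> (\<exists>\<Theta>0 i. director_cond N t n \<phi> \<Theta>0 \<and> D = Dsp N t \<phi> \<Theta>0 \<and>
      i < t \<and> \<Theta> = (\<phi> ^^ i) ` \<Theta>0)"

definition proj :: "'k::field vect set \<Rightarrow> 'k vect set \<Rightarrow> 'k vect set set \<Rightarrow> 'k vect set set" where
  "proj \<Gamma> \<Lambda> S = {kspan (\<Gamma> \<union> P) \<inter> \<Lambda> | P. P \<in> S}"

definition linset :: "'k::field vect set \<Rightarrow> 'k vect set set" where
  "linset U = {kspan {u} | u. u \<in> U \<and> u \<noteq> 0}"

definition scattered :: "nat \<Rightarrow> 'k::field vect set \<Rightarrow> bool" where
  "scattered q U \<longleftrightarrow> (\<forall>u\<in>U. u \<noteq> 0 \<longrightarrow> fqdim q (U \<inter> kspan {u}) = 1)"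

definition linear_set :: "nat \<Rightarrow> 'k::field vect set \<Rightarrow> nat \<Rightarrow> 'k vect set set \<Rightarrow> bool" where
  "linear_set q \<Lambda> r L \<longleftrightarrow> (\<exists>U. fqsub q U \<and> U \<subseteq> \<Lambda> \<and> fqdim q U = r \<and> L = linset U)"

definition scattered_linear_set :: "nat \<Rightarrow> 'k::field vect set \<Rightarrow> nat \<Rightarrow> 'k vect set set \<Rightarrow> bool" where
  "scattered_linear_set q \<Lambda> r L \<longleftrightarrow>
     (\<exists>U. fqsub q U \<and> U \<subseteq> \<Lambda> \<and> fqdim q U = r \<and> scattered q U \<and> L = linset U)"

definition type_L_rho_f :: "nat \<Rightarrow> nat \<Rightarrow> nat \<Rightarrow> 'k::field vect set \<Rightarrow> 'k vect set set \<Rightarrow> bool" where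
  "type_L_rho_f q N n \<Lambda> L \<longleftrightarrow> (\<exists>U1 U2 f \<sigma> \<rho>.
     ksub N U1 \<and> ksub N U2 \<and> U1 \<inter> U2 = {0} \<and> kspan (U1 \<union> U2) = \<Lambda> \<and>
     kdim U1 = n \<and> kdim U2 = n \<and>
     semilinear_on U1 U2 f \<sigma> \<and> {x. \<sigma> x = x} = Fq q \<and> \<rho> \<noteq> 0 \<and>
     L = {kspan {u + sc \<rho> (f u)} | u. u \<in> U1 \<and> u \<noteq> 0})"

definition pseudoregulus_type :: "nat \<Rightarrow> nat \<Rightarrow> nat \<Rightarrow> nat \<Rightarrow> 'k::field vect set \<Rightarrow> 'k vect set set
     \<Rightarrow> 'k vect set \<Rightarrow> 'k vect set \<Rightarrow> bool" where
  "pseudoregulus_type q N t n \<Lambda> L T1 T2 \<longleftrightarrow>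
     scattered_linear_set q \<Lambda> (t * n) L \<and>
     (\<exists>S. finite S \<and> card S = (q ^ (n * t) - 1) div (q ^ t - 1) \<and>
        (\<forall>l\<in>S. ksub N l \<and> l \<subseteq> \<Lambda> \<and> kdim l = 2 \<and> linear_set q l t {P \<in> L. P \<subseteq> l}) \<and>
        (\<forall>l1\<in>S. \<forall>l2\<in>S. l1 \<noteq> l2 \<longrightarrow> l1 \<inter> l2 = {0}) \<and>
        T1 \<noteq> T2 \<and>
        {T. ksub N T \<and> T \<subseteq> \<Lambda> \<and> kdim T = n \<and> (\<forall>P\<in>L. \<not> P \<subseteq> T) \<and> (\<forall>l\<in>S. l \<inter> T \<noteq> {0})}
          = {T1, T2})"

end

theory Submission
  imports Defs Complex_Main "HOL-Library.FuncSet" "HOL-Library.Cardinality"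
begin

text \<open>
  Since \<open>\<phi>\<close> fixes the points of the basis vectors of the subgeometry and of their sum, \<open>\<phi>\<close> has one eigenvalue \<open>\<mu>\<close> on all
  of them, so \<open>\<psi> = \<mu>\<^sup>-\<^sup>1 \<phi>\<close> acts on coordinates by \<open>\<sigma>\<close>, satisfies \<open>\<psi>\<^sup>t = 1\<close> and
  induces the same collineation. The conjugates of \<open>\<Theta>\<close> form a direct sum, hence the vectors fixed
  by \<open>\<psi>\<close> are the orbit sums of the vectors of \<open>\<Theta>\<close>, and projecting from \<open>\<Gamma>\<close> keeps the two summands with
  indices \<open>i1\<close> and \<open>i2\<close>: the projection is the linear set of the graph of a power \<open>g\<close> of \<open>\<psi>\<close> whose
  companion automorphism still has fixed field \<open>F\<^sub>q\<close>, as \<open>i2 - i1\<close> is prime to \<open>t\<close>.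

  The lines \<open>\<langle>u, g u\<rangle>\<close> exhibit the pseudoregulus. By counting, every point of a transversal
  space \<open>T\<close> is on one of these lines; a vector \<open>u + \<beta> g u\<close> of \<open>T\<close> with \<open>\<beta> \<noteq> 0\<close>, added to a vector of \<open>T\<close>
  on another line, would violate this because \<open>g\<close> is not linear. Hence \<open>T\<close> is one of the two components.

  Since the field is finite, dimensions are computed throughout as logarithms of cardinalities.
\<close>

section \<open>Vector spaces over a finite field\<close>

interpretation vs: vector_space "sc :: 'k::field \<Rightarrow> 'k vect \<Rightarrow> 'k vect"
  by unfold_locales (auto simp: sc_def plus_fun_def algebra_simps)

lemma kspan_eq_span: "kspan S = vs.span S"
  unfolding lspan_def vs.span_explicit by auto

lemma subspace_vecs: "vs.subspace (vecs N :: 'k::field vect set)"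
  by (auto simp: vs.subspace_def vecs_def sc_def)

lemma ksub_iff: "ksub N W \<longleftrightarrow> W \<subseteq> vecs N \<and> vs.subspace W"
  by (auto simp: ksub_def kspan_eq_span vs.span_eq_iff)

text \<open>Extension by zero is a bijection from the functions on \<open>{..<N}\<close> onto
  \<open>vecs N\<close>; the functions in \<open>?P\<close> are undefined beyond \<open>N\<close>,
  which is why \<open>?h\<close> overwrites those values.\<close>

lemma card_vecs: "card (vecs N :: 'k::{finite,field} vect set) = CARD('k) ^ N"
  and finite_vecs: "finite (vecs N :: 'k::{finite,field} vect set)"
proof -
  let ?h = "\<lambda>(f::'k vect) i. if i < N then f i else 0"
  let ?P = "PiE {..<N} (\<lambda>_. UNIV :: 'k set)"
  have "?h ` ?P = vecs N"
  proof
    show "vecs N \<subseteq> ?h ` ?P"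
    proof
      fix v :: "'k vect" assume "v \<in> vecs N"
      then show "v \<in> ?h ` ?P"
        by (intro image_eqI[of _ _ "restrict v {..<N}"]) (auto simp: vecs_def fun_eq_iff)
    qed
    show "?h ` ?P \<subseteq> vecs N"
      unfolding vecs_def by force
  qed
  moreover have "inj_on ?h ?P"
  proof (rule inj_onI)
    fix f g assume fg: "f \<in> ?P" "g \<in> ?P" and eq: "?h f = ?h g"
    have "f i = g i" if "i \<in> {..<N}" for i
      using fun_cong[OF eq, of i] that by simp
    with fg show "f = g" by (rule PiE_ext)
  qed
  ultimately have bij: "bij_betw ?h ?P (vecs N)"
    by (simp add: bij_betw_def)
  show "card (vecs N :: 'k vect set) = CARD('k) ^ N"
    using bij_betw_same_card[OF bij] by (simp add: card_PiE)
  show "finite (vecs N :: 'k vect set)"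
    using bij_betw_finite[OF bij] by (simp add: finite_PiE)
qed

text \<open>A predicate on sets, to match the scalar set of \<open>lspan\<close>; it is applied to
  \<open>UNIV\<close> and to \<open>Fq q\<close>. The clause for inverses can include 0 because
  \<open>inverse 0 = 0\<close>.\<close>

definition subfield :: "'k::field set \<Rightarrow> bool" where
  "subfield C \<longleftrightarrow> 0 \<in> C \<and> 1 \<in> C \<and> (\<forall>x\<in>C. \<forall>y\<in>C. x + y \<in> C \<and> x * y \<in> C) \<and>
     (\<forall>x\<in>C. - x \<in> C \<and> inverse x \<in> C)"

lemma subfieldD:
  assumes "subfield C"
  shows "0 \<in> C" "1 \<in> C" "x \<in> C \<Longrightarrow> y \<in> C \<Longrightarrow> x + y \<in> C" "x \<in> C \<Longrightarrow> y \<in> C \<Longrightarrow> x * y \<in> C"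
    "x \<in> C \<Longrightarrow> - x \<in> C" "x \<in> C \<Longrightarrow> inverse x \<in> C"
  using assms unfolding subfield_def by blast+

lemma subfield_UNIV: "subfield UNIV"
  by (simp add: subfield_def)

section \<open>Spans over a set of scalars, and dimension as a logarithm of cardinality\<close>

lemma lspan_least:
  assumes "S \<subseteq> W" "0 \<in> W" "\<And>u v. u \<in> W \<Longrightarrow> v \<in> W \<Longrightarrow> u + v \<in> W"
    and "\<And>c u. c \<in> C \<Longrightarrow> u \<in> W \<Longrightarrow> sc c u \<in> W"
  shows "lspan C S \<subseteq> W"
proof
  fix v assume "v \<in> lspan C S"
  then obtain F c where F: "finite F" "F \<subseteq> S" "\<forall>x\<in>F. c x \<in> C" "v = (\<Sum>x\<in>F. sc (c x) x)"
    by (auto simp: lspan_def)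
  from F(1-3) have "(\<Sum>x\<in>F. sc (c x) x) \<in> W"
    by (induction F rule: finite_induct) (use assms in auto)
  with F(4) show "v \<in> W" by simp
qed

lemma lspan_base:
  assumes "1 \<in> C" "x \<in> S"
  shows "x \<in> lspan C S"
  unfolding lspan_def using assms
  by (intro CollectI exI[of _ "{x}"] exI[of _ "\<lambda>_. 1"]) auto

lemma lspan_mono: "S \<subseteq> T \<Longrightarrow> lspan C S \<subseteq> lspan C T"
  unfolding lspan_def by blast

lemma sum_in_lspan:
  assumes "finite F" "\<And>x. x \<in> F \<Longrightarrow> c x \<in> C"
  shows "(\<Sum>x\<in>F. sc (c x) x) \<in> lspan C F"
  unfolding lspan_def using assms by (intro CollectI exI[of _ F] exI[of _ c]) simp

text \<open>Coefficients missing from a combination are filled up with 0, so that the span becomes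
  the image of one function space and can be counted.\<close>

lemma lspan_finite:
  assumes "finite B" "0 \<in> C"
  shows "lspan C B = (\<lambda>c. \<Sum>x\<in>B. sc (c x) x) ` (B \<rightarrow>\<^sub>E C)"
proof
  show "lspan C B \<subseteq> (\<lambda>c. \<Sum>x\<in>B. sc (c x) x) ` (B \<rightarrow>\<^sub>E C)"
  proof
    fix v assume "v \<in> lspan C B"
    then obtain F c where F: "finite F" "F \<subseteq> B" "\<forall>x\<in>F. c x \<in> C" "v = (\<Sum>x\<in>F. sc (c x) x)"
      by (auto simp: lspan_def)
    let ?d = "restrict (\<lambda>x. if x \<in> F then c x else 0) B"
    have "v = (\<Sum>x\<in>B. sc (?d x) x)"
      unfolding F(4) by (rule sum.mono_neutral_cong_left) (use F(2) assms in auto)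
    moreover have "?d \<in> B \<rightarrow>\<^sub>E C"
      using F(3) assms by auto
    ultimately show "v \<in> (\<lambda>c. \<Sum>x\<in>B. sc (c x) x) ` (B \<rightarrow>\<^sub>E C)"
      by blast
  qed
  show "(\<lambda>c. \<Sum>x\<in>B. sc (c x) x) ` (B \<rightarrow>\<^sub>E C) \<subseteq> lspan C B"
  proof (rule image_subsetI)
    fix c assume "c \<in> B \<rightarrow>\<^sub>E C"
    with assms(1) show "(\<Sum>x\<in>B. sc (c x) x) \<in> lspan C B"
      by (intro sum_in_lspan) auto
  qed
qed

lemma lspan_finite_add:
  assumes "finite B" "subfield C" "u \<in> lspan C B" "v \<in> lspan C B"
  shows "u + v \<in> lspan C B"
proof -
  note C0 = subfieldD(1)[OF assms(2)]
  obtain c d where c: "c \<in> B \<rightarrow>\<^sub>E C" "u = (\<Sum>x\<in>B. sc (c x) x)"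
    and d: "d \<in> B \<rightarrow>\<^sub>E C" "v = (\<Sum>x\<in>B. sc (d x) x)"
    using assms(3,4) unfolding lspan_finite[OF assms(1) C0] by blast
  have "\<forall>x\<in>B. c x + d x \<in> C"
    using c(1) d(1) by (auto intro!: subfieldD(3)[OF assms(2)])
  moreover have "u + v = (\<Sum>x\<in>B. sc (c x + d x) x)"
    by (simp add: c d vs.scale_left_distrib sum.distrib)
  ultimately show ?thesis
    using sum_in_lspan[OF assms(1), of "\<lambda>x. c x + d x"] by simp
qed

lemma lspan_finite_scale:
  assumes "finite B" "subfield C" "u \<in> lspan C B" "a \<in> C"
  shows "sc a u \<in> lspan C B"
proof -
  note C0 = subfieldD(1)[OF assms(2)]
  obtain c where c: "c \<in> B \<rightarrow>\<^sub>E C" "u = (\<Sum>x\<in>B. sc (c x) x)"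
    using assms(3) unfolding lspan_finite[OF assms(1) C0] by blast
  have "\<forall>x\<in>B. a * c x \<in> C"
    using c(1) assms(4) by (auto intro!: subfieldD(4)[OF assms(2)])
  moreover have "sc a u = (\<Sum>x\<in>B. sc (a * c x) x)"
    by (simp add: c vs.scale_sum_right)
  ultimately show ?thesis
    using sum_in_lspan[OF assms(1), of "\<lambda>x. a * c x"] by simp
qed

text \<open>A generating set \<open>B\<close> of least size is independent, since a nontrivial
  relation would express one member by the others, which would then suffice. Hence vectors of
  \<open>W\<close> correspond to coefficient functions on \<open>B\<close>.\<close>

lemma card_eq_power_ldim:
  fixes W :: "'k::{finite,field} vect set"
  assumes C: "subfield C" and fin: "finite W" and W: "lspan C W = W"
  shows "card W = card C ^ ldim C W"
proof -
  let ?P = "\<lambda>k. \<exists>B. finite B \<and> card B = k \<and> lspan C B = W"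
  have "?P (card W)" using fin W by (intro exI[of _ W]) simp
  then have "?P (ldim C W)" unfolding ldim_def by (rule LeastI)
  then obtain B where B: "finite B" "card B = ldim C W" "lspan C B = W" by blast
  have least: "ldim C W \<le> card B'" if "finite B'" "lspan C B' = W" for B'
    unfolding ldim_def using that by (intro Least_le exI[of _ B']) simp
  note C0 = subfieldD(1)[OF C] and C1 = subfieldD(2)[OF C]
  have "inj_on (\<lambda>c. \<Sum>x\<in>B. sc (c x) x) (B \<rightarrow>\<^sub>E C)"
  proof (rule inj_onI, rule ccontr)
    fix c d assume c: "c \<in> B \<rightarrow>\<^sub>E C" and d: "d \<in> B \<rightarrow>\<^sub>E C" and "c \<noteq> d"
      and eq: "(\<Sum>x\<in>B. sc (c x) x) = (\<Sum>x\<in>B. sc (d x) x)"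
    have "\<exists>x\<in>B. c x \<noteq> d x"
      using PiE_ext[OF c d] \<open>c \<noteq> d\<close> by blast
    then obtain x0 where x0: "x0 \<in> B" "c x0 \<noteq> d x0" by blast
    define e where "e x = c x - d x" for x
    have e0: "e x0 \<noteq> 0" using x0 by (simp add: e_def)
    have eC: "e x \<in> C" if "x \<in> B" for x
    proof -
      have "c x \<in> C" "d x \<in> C" using c d that by auto
      then have "c x + - d x \<in> C" by (intro subfieldD(3,5)[OF C])
      then show ?thesis by (simp add: e_def)
    qed
    let ?B = "B - {x0}"
    \<comment> \<open>The difference of the two coefficient functions is a relation; it is solved
      for \<open>x0\<close>, where it has a nonzero coefficient.\<close>
    have "0 = (\<Sum>x\<in>B. sc (e x) x)"
      by (simp add: e_def vs.scale_left_diff_distrib sum_subtractf eq)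
    also have "\<dots> = sc (e x0) x0 + (\<Sum>x\<in>?B. sc (e x) x)"
      using sum.remove[OF B(1) x0(1)] by simp
    finally have "sc (e x0) x0 = - (\<Sum>x\<in>?B. sc (e x) x)"
      by (simp only: eq_neg_iff_add_eq_0)
    then have "sc (inverse (e x0)) (sc (e x0) x0) = sc (- inverse (e x0)) (\<Sum>x\<in>?B. sc (e x) x)"
      by (simp only: vs.scale_minus_left vs.scale_minus_right)
    then have x0eq: "x0 = sc (- inverse (e x0)) (\<Sum>x\<in>?B. sc (e x) x)"
      using e0 by simp
    have "(\<Sum>x\<in>?B. sc (e x) x) \<in> lspan C ?B"
      using B(1) eC by (intro sum_in_lspan) auto
    moreover have "- inverse (e x0) \<in> C"
      by (intro subfieldD(5,6)[OF C] eC x0(1))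
    ultimately have "sc (- inverse (e x0)) (\<Sum>x\<in>?B. sc (e x) x) \<in> lspan C ?B"
      using B(1) C by (intro lspan_finite_scale) simp_all
    then have "x0 \<in> lspan C ?B"
      by (simp only: x0eq[symmetric])
    moreover have "x \<in> lspan C ?B" if "x \<in> B" "x \<noteq> x0" for x
      using that by (intro lspan_base[OF C1]) simp
    ultimately have sub: "B \<subseteq> lspan C ?B"
      by (metis subsetI)
    have "lspan C B \<subseteq> lspan C ?B"
    proof (rule lspan_least[OF sub])
      show "0 \<in> lspan C ?B" unfolding lspan_def by (intro CollectI exI[of _ "{}"]) simp
      show "u + v \<in> lspan C ?B" if "u \<in> lspan C ?B" "v \<in> lspan C ?B" for u v
        using B(1) C that by (intro lspan_finite_add) simp_all
      show "sc c u \<in> lspan C ?B" if "c \<in> C" "u \<in> lspan C ?B" for c u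
        using B(1) C that by (intro lspan_finite_scale) simp_all
    qed
    \<comment> \<open>Dropping \<open>x0\<close> leaves a smaller generating set, against the
      minimality of \<open>ldim\<close>.\<close>
    then have "lspan C ?B = W"
      using B(3) lspan_mono[of ?B B C] by auto
    from least[OF _ this] B(1) have "card B \<le> card ?B" by (simp add: B(2))
    then show False using B(1) x0(1) by (metis card_Diff1_less not_le)
  qed
  then have "card (lspan C B) = card (B \<rightarrow>\<^sub>E C)"
    unfolding lspan_finite[OF B(1) C0] by (rule card_image)
  then show ?thesis using B by (simp add: card_PiE)
qed

text \<open>A subfield contains 0 and 1, so its cardinality exceeds 1 and the exponent can be read
  off from the power.\<close>

lemma ldim_eqI:
  fixes W :: "'k::{finite,field} vect set"
  assumes C: "subfield C" and "finite W" "lspan C W = W" and k: "card W = card C ^ k"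
  shows "ldim C W = k"
proof -
  have "{0, 1} \<subseteq> C" using subfieldD[OF C] by simp
  then have "card {0, 1 :: 'k} \<le> card C" by (intro card_mono) auto
  then have "1 < card C" by simp
  moreover have "card C ^ ldim C W = card C ^ k"
    using card_eq_power_ldim[OF C assms(2,3)] k by simp
  ultimately show ?thesis by simp
qed

lemma card_ksub:
  fixes W :: "'k::{finite,field} vect set"
  assumes "ksub N W"
  shows "card W = CARD('k) ^ kdim W"
  using assms finite_subset[OF _ finite_vecs] subfield_UNIV
  by (intro card_eq_power_ldim) (auto simp: ksub_def)

lemma kdim_eqI:
  fixes W :: "'k::{finite,field} vect set"
  assumes "ksub N W" "card W = CARD('k) ^ k"
  shows "kdim W = k"
  using assms finite_subset[OF _ finite_vecs] subfield_UNIV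
  by (intro ldim_eqI) (auto simp: ksub_def)

lemma fqdim_eqI:
  fixes U :: "'k::{finite,field} vect set"
  assumes Fq: "subfield (Fq q :: 'k set)" and U: "fqsub q U" "U \<subseteq> vecs N"
    and k: "card U = card (Fq q :: 'k set) ^ k"
  shows "fqdim q U = k"
  unfolding fqdim_def
proof (rule ldim_eqI[OF Fq _ _ k])
  show "finite U" using U(2) finite_vecs finite_subset by blast
  have "lspan (Fq q) U \<subseteq> U"
    by (rule lspan_least) (use U(1) in \<open>auto simp: fqsub_def\<close>)
  moreover have "1 \<in> (Fq q :: 'k set)" using subfieldD[OF Fq] by simp
  ultimately show "lspan (Fq q) U = U" using lspan_base by blast
qed

text \<open>Used to see that \<open>Fq q\<close> is a subfield. The equation
  \<open>x ^ q = x\<close> is not additive for arbitrary \<open>q\<close>, but later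
  \<open>Fq q\<close> is always the fixed set of an automorphism.\<close>

lemma subfield_fixed_set:
  assumes "field_aut \<sigma>"
  shows "subfield {x. \<sigma> x = x}"
proof -
  from assms have add: "\<sigma> (x + y) = \<sigma> x + \<sigma> y" and mult: "\<sigma> (x * y) = \<sigma> x * \<sigma> y"
    and inj: "\<sigma> x = \<sigma> y \<Longrightarrow> x = y" for x y
    by (auto simp: field_aut_def bij_def inj_def)
  have z: "\<sigma> 0 = 0" using add[of 0 0] by (metis add.right_neutral add_cancel_left_right)
  have "\<sigma> 1 \<noteq> 0" using inj[of 1 0] z by auto
  then have o: "\<sigma> 1 = 1" using mult[of 1 1] by simp
  have "\<sigma> (- x) = - \<sigma> x" for x
    using add[of x "- x"] z by (metis add.right_inverse add_left_cancel)
  moreover have "\<sigma> (inverse x) = inverse (\<sigma> x)" for x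
  proof (cases "x = 0")
    case False
    then have "\<sigma> x * \<sigma> (inverse x) = 1" using mult[of x "inverse x"] o by simp
    then show ?thesis by (metis inverse_unique)
  qed (simp add: z)
  ultimately show ?thesis
    unfolding subfield_def by (simp add: z o add mult)
qed

section \<open>Linear sets of pseudoregulus type\<close>

lemma span_pair: "vs.span {u, v} = {sc a u + sc b v | a b. True}"
  by (auto simp: vs.span_insert vs.span_singleton image_iff diff_eq_eq add.commute)

lemma span_Un_subspace:
  assumes "vs.subspace A" "vs.subspace B"
  shows "vs.span (A \<union> B) = {x + y | x y. x \<in> A \<and> y \<in> B}"
proof -
  have eq: "vs.span A = A" "vs.span B = B" using assms by (auto simp: vs.span_eq_iff)
  show ?thesis unfolding vs.span_Un eq by auto
qed

lemma ksub_span: "S \<subseteq> vecs N \<Longrightarrow> ksub N (vs.span S)"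
  by (simp add: ksub_iff vs.span_minimal subspace_vecs)

lemma ksub_finite: "ksub N W \<Longrightarrow> finite (W :: 'k::{finite,field} vect set)"
  using finite_subset[OF _ finite_vecs] by (auto simp: ksub_iff)

text \<open>To be instantiated with two conjugates of \<open>\<Theta>\<close> and a power of
  \<open>\<psi>\<close>. Everything about scatteredness and pseudoreguli depends on these data
  alone, without reference to a projection.\<close>

locale semilinear_pair =
  fixes q t n N :: nat and T1 T2 :: "'k::{finite,field} vect set"
    and g :: "'k vect \<Rightarrow> 'k vect" and \<tau> :: "'k \<Rightarrow> 'k"
  assumes n_ge: "2 \<le> n" and t_ge: "2 \<le> t"
    and card_K: "CARD('k) = q ^ t" and card_Fq: "card (Fq q :: 'k set) = q"
    and ksub1: "ksub N T1" and ksub2: "ksub N T2"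
    and kdim1: "kdim T1 = n" and kdim2: "kdim T2 = n"
    and disj: "T1 \<inter> T2 = {0}"
    and semilin: "semilinear_on T1 T2 g \<tau>" and fixed: "{x. \<tau> x = x} = Fq q"
begin

definition "\<Lambda> = kspan (T1 \<union> T2)"
text \<open>The graph of \<open>g\<close> inside the direct sum of \<open>T1\<close> and
  \<open>T2\<close>; multiplication by a scalar preserves it when \<open>\<tau>\<close> fixes that
  scalar.\<close>

definition "U = (\<lambda>u. u + g u) ` T1"
definition "line u = kspan {u, g u}"
definition "lines = line ` (T1 - {0})"

lemma subspace1: "vs.subspace T1" and subspace2: "vs.subspace T2"
  using ksub1 ksub2 by (auto simp: ksub_iff)

lemma g_mem: "u \<in> T1 \<Longrightarrow> g u \<in> T2"
  and g_add: "u \<in> T1 \<Longrightarrow> v \<in> T1 \<Longrightarrow> g (u + v) = g u + g v"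
  and g_scale: "u \<in> T1 \<Longrightarrow> g (sc c u) = sc (\<tau> c) (g u)"
  and g_inj: "inj_on g T1" and g_image: "g ` T1 = T2"
  and field_aut_\<tau>: "field_aut \<tau>"
  using semilin by (auto simp: semilinear_on_def bij_betw_def)

lemma zero_mem: "0 \<in> T1" "0 \<in> T2"
  using subspace1 subspace2 vs.subspace_0 by auto

lemma \<tau>_add: "\<tau> (x + y) = \<tau> x + \<tau> y" and \<tau>_mult: "\<tau> (x * y) = \<tau> x * \<tau> y"
  and \<tau>_surj: "\<exists>x. \<tau> x = y"
  using field_aut_\<tau> unfolding field_aut_def bij_def surj_def by metis+

lemma \<tau>_0: "\<tau> 0 = 0" and \<tau>_eq_0_iff: "\<tau> x = 0 \<longleftrightarrow> x = 0"
proof -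
  show z: "\<tau> 0 = 0" using \<tau>_add[of 0 0] by (metis add.right_neutral add_cancel_left_right)
  show "\<tau> x = 0 \<longleftrightarrow> x = 0"
    using field_aut_\<tau> z unfolding field_aut_def bij_def inj_def by metis
qed

lemma g_eq_0_iff: "u \<in> T1 \<Longrightarrow> g u = 0 \<longleftrightarrow> u = 0"
  using g_scale[OF zero_mem(1), of 0] g_inj zero_mem \<tau>_0
  by (metis inj_onD vs.scale_zero_left)

lemma subfield_Fq: "subfield (Fq q :: 'k set)"
  using subfield_fixed_set[OF field_aut_\<tau>] fixed by simp

lemma mem_Fq_iff: "c \<in> Fq q \<longleftrightarrow> \<tau> c = c"
  using fixed by auto

lemma q_ge: "2 \<le> q"
proof (rule ccontr)
  assume "\<not> 2 \<le> q"
  then have "q = 0 \<or> q = 1" by auto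
  then have "q ^ t \<le> 1" using t_ge by (auto simp: power_0_left)
  moreover have "card {0, 1 :: 'k} \<le> CARD('k)" by (intro card_mono) auto
  ultimately show False using card_K by simp
qed

text \<open>The fixed field has \<open>q\<close> elements, the whole field \<open>q ^ t\<close>. So
  \<open>g\<close> is not linear, and this excludes further transversal spaces below.\<close>

lemma \<tau>_nontrivial: "\<exists>s. \<tau> s \<noteq> s"
proof (rule ccontr)
  assume "\<not> ?thesis"
  then have "Fq q = (UNIV :: 'k set)" using fixed by auto
  then have "q ^ t = q ^ 1" using card_Fq card_K by simp
  then show False using q_ge t_ge by (subst (asm) power_inject_exp) auto
qed

lemma decomposition_unique:
  assumes "x \<in> T1" "x' \<in> T1" "y \<in> T2" "y' \<in> T2" "x + y = x' + y'"
  shows "x = x'" "y = y'"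
proof -
  have "x - x' = y' - y" using assms(5) by (simp add: algebra_simps)
  moreover have "x - x' \<in> T1" "y' - y \<in> T2"
    using assms subspace1 subspace2 vs.subspace_diff by auto
  ultimately have "x - x' \<in> T1 \<inter> T2" by auto
  then have "x - x' = 0" using disj by simp
  then show "x = x'" "y = y'" using assms(5) by auto
qed

lemma \<Lambda>_eq: "\<Lambda> = {x + y | x y. x \<in> T1 \<and> y \<in> T2}"
  unfolding \<Lambda>_def kspan_eq_span by (rule span_Un_subspace[OF subspace1 subspace2])

lemma ksub_\<Lambda>: "ksub N \<Lambda>"
  unfolding \<Lambda>_def kspan_eq_span using ksub1 ksub2 by (intro ksub_span) (auto simp: ksub_def)

lemma subset_\<Lambda>: "T1 \<subseteq> \<Lambda>" "T2 \<subseteq> \<Lambda>"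
  unfolding \<Lambda>_def kspan_eq_span using vs.span_superset by blast+

lemma U_subset: "U \<subseteq> \<Lambda>"
  unfolding U_def \<Lambda>_eq using g_mem by auto

lemma graph_scale: "u \<in> T1 \<Longrightarrow> c \<in> Fq q \<Longrightarrow> sc c (u + g u) = sc c u + g (sc c u)"
  by (simp add: g_scale mem_Fq_iff vs.scale_right_distrib)

lemma fqsub_U: "fqsub q U"
  unfolding fqsub_def
proof (intro conjI ballI)
  show "0 \<in> U"
    unfolding U_def using zero_mem(1) g_eq_0_iff[OF zero_mem(1)] by force
next
  fix u v assume "u \<in> U" "v \<in> U"
  then obtain x y where x: "x \<in> T1" "u = x + g x" and y: "y \<in> T1" "v = y + g y"
    by (auto simp: U_def)
  then have "u + v = (x + y) + g (x + y)" by (simp add: g_add algebra_simps)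
  then show "u + v \<in> U" unfolding U_def using vs.subspace_add[OF subspace1] x y by blast
next
  fix c :: 'k and u assume "c \<in> Fq q" "u \<in> U"
  then show "sc c u \<in> U"
    unfolding U_def using vs.subspace_scale[OF subspace1] graph_scale by blast
qed

lemma inj_graph: "inj_on (\<lambda>u. u + g u) T1"
  using decomposition_unique(1) g_mem by (intro inj_onI) blast

lemma graph_eq_0_iff: "u \<in> T1 \<Longrightarrow> u + g u = 0 \<longleftrightarrow> u = 0"
  using decomposition_unique(1)[of u 0 "g u" 0] zero_mem g_mem g_eq_0_iff by auto

lemma card_T: "card T1 = CARD('k) ^ n" "card T2 = CARD('k) ^ n"
  using card_ksub[OF ksub1] card_ksub[OF ksub2] kdim1 kdim2 by auto

lemma U_subset_vecs: "U \<subseteq> vecs N"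
  using U_subset ksub_\<Lambda> by (auto simp: ksub_def)

text \<open>The graph has as many vectors as \<open>T1\<close>, namely
  \<open>(q ^ t) ^ n\<close>.\<close>

lemma fqdim_U: "fqdim q U = t * n"
proof (rule fqdim_eqI[OF subfield_Fq fqsub_U U_subset_vecs])
  show "card U = card (Fq q :: 'k set) ^ (t * n)"
    unfolding U_def card_image[OF inj_graph]
    by (simp add: card_T card_K card_Fq power_mult)
qed

text \<open>The reason for scatteredness: multiplying by \<open>c\<close> scales the
  \<open>T2\<close> component by \<open>c\<close>, but membership in the graph demands the factor
  \<open>\<tau> c\<close>. Since \<open>g u\<close> is nonzero, the two factors agree.\<close>

lemma kspan_graph_mem:
  assumes "u \<in> T1" "u \<noteq> 0" "v \<in> U" "v = sc c (u + g u)"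
  shows "c \<in> Fq q"
proof -
  obtain w where w: "w \<in> T1" "v = w + g w" using assms(3) by (auto simp: U_def)
  have "w + g w = sc c u + sc c (g u)"
    using assms(4) w by (simp add: vs.scale_right_distrib)
  then have "w = sc c u" "g w = sc c (g u)"
    using decomposition_unique[of w "sc c u" "g w" "sc c (g u)"] w(1) assms(1)
      vs.subspace_scale[OF subspace1] vs.subspace_scale[OF subspace2] g_mem by auto
  then have "sc (\<tau> c) (g u) = sc c (g u)"
    using assms(1) g_scale by auto
  moreover have "g u \<noteq> 0" using assms(1,2) g_eq_0_iff by blast
  ultimately show ?thesis by (simp add: mem_Fq_iff vs.scale_cancel_right)
qed

lemma scattered_U: "scattered q U"
  unfolding scattered_def
proof (intro ballI impI)
  fix v assume v: "v \<in> U" "v \<noteq> 0"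
  then obtain u where u: "u \<in> T1" "v = u + g u" by (auto simp: U_def)
  with v have u0: "u \<noteq> 0" using graph_eq_0_iff by auto
  have sc_U: "sc c v \<in> U" if "c \<in> Fq q" for c
    using fqsub_U v(1) that by (auto simp: fqsub_def)
  have eq: "U \<inter> kspan {v} = (\<lambda>c. sc c v) ` Fq q"
    using kspan_graph_mem[OF u(1) u0] sc_U u(2)
    by (auto simp: kspan_eq_span vs.span_singleton)
  have "inj_on (\<lambda>c. sc c v) (Fq q)"
    using v(2) by (auto simp: inj_on_def vs.scale_cancel_right)
  then have card: "card (U \<inter> kspan {v}) = card (Fq q :: 'k set) ^ 1"
    unfolding eq by (simp add: card_image)
  have "fqsub q (U \<inter> kspan {v})"
    using fqsub_U vs.subspace_0[OF vs.subspace_span] vs.subspace_add[OF vs.subspace_span]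
      vs.subspace_scale[OF vs.subspace_span]
    by (auto simp: fqsub_def kspan_eq_span)
  then show "fqdim q (U \<inter> kspan {v}) = 1"
    using fqdim_eqI[OF subfield_Fq _ _ card] U_subset_vecs by blast
qed

lemma scattered_linear_set_U: "scattered_linear_set q \<Lambda> (t * n) (linset U)"
  unfolding scattered_linear_set_def
  using fqsub_U U_subset fqdim_U scattered_U by blast

lemma linset_U: "linset U = {kspan {u + g u} | u. u \<in> T1 \<and> u \<noteq> 0}"
  unfolding linset_def U_def using graph_eq_0_iff by blast

text \<open>The graph is the case \<open>\<rho> = 1\<close>.\<close>

lemma type_L_rho_f_U: "type_L_rho_f q N n \<Lambda> (linset U)"
  unfolding type_L_rho_f_def
  using ksub1 ksub2 disj kdim1 kdim2 semilin fixed linset_U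
  by (intro exI[of _ T1] exI[of _ T2] exI[of _ g] exI[of _ \<tau>] exI[of _ 1])
    (simp add: \<Lambda>_def)

section \<open>The lines joining a point of \<open>T1\<close> to its image in
  \<open>T2\<close>\<close>

lemma mem_line_iff: "v \<in> line u \<longleftrightarrow> (\<exists>a b. v = sc a u + sc b (g u))"
  by (simp add: line_def kspan_eq_span span_pair)

lemma subspace_line: "vs.subspace (line u)"
  unfolding line_def kspan_eq_span by (rule vs.subspace_span)

lemma line_subset: "u \<in> T1 \<Longrightarrow> line u \<subseteq> \<Lambda>"
  using subspace1 subspace2 g_mem vs.subspace_scale unfolding \<Lambda>_eq mem_line_iff subset_iff by blast

lemma ksub_line: "u \<in> T1 \<Longrightarrow> ksub N (line u)"
  using line_subset[of u] ksub_\<Lambda> subspace_line by (auto simp: ksub_iff)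

text \<open>Rescaling \<open>u\<close> by \<open>c\<close> rescales \<open>g u\<close> by the
  nonzero factor \<open>\<tau> c\<close>, so the two generators keep their points. The line thus
  depends on the point of \<open>u\<close> only.\<close>

lemma line_scale:
  assumes "u \<in> T1" "c \<noteq> 0"
  shows "line (sc c u) = line u"
proof -
  have c: "\<tau> c \<noteq> 0" using assms \<tau>_eq_0_iff by simp
  have forward: "sc a u + sc b (g u) = sc (a / c) (sc c u) + sc (b / \<tau> c) (g (sc c u))" for a b
    using assms c by (simp add: g_scale)
  have backward: "sc a (sc c u) + sc b (g (sc c u)) = sc (a * c) u + sc (b * \<tau> c) (g u)" for a b
    using assms by (simp add: g_scale)
  show ?thesis
  proof (intro set_eqI iffI)
    fix v assume "v \<in> line (sc c u)"
    then obtain a b where "v = sc a (sc c u) + sc b (g (sc c u))"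
      unfolding mem_line_iff by blast
    then have "v = sc (a * c) u + sc (b * \<tau> c) (g u)"
      by (simp only: backward)
    then show "v \<in> line u" unfolding mem_line_iff by blast
  next
    fix v assume "v \<in> line u"
    then obtain a b where "v = sc a u + sc b (g u)"
      unfolding mem_line_iff by blast
    then have "v = sc (a / c) (sc c u) + sc (b / \<tau> c) (g (sc c u))"
      by (simp only: forward)
    then show "v \<in> line (sc c u)" unfolding mem_line_iff by blast
  qed
qed

lemma line_components:
  assumes "u \<in> T1" "x \<in> T1" "y \<in> T2" "x + y = sc a u + sc b (g u)"
  shows "x = sc a u" "y = sc b (g u)"
  using decomposition_unique[of x "sc a u" y "sc b (g u)"] assms
    vs.subspace_scale[OF subspace1] vs.subspace_scale[OF subspace2] g_mem by auto

text \<open>Compare components of the common vector. A nonzero \<open>T1\<close> component makes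
  \<open>u\<close> a multiple of \<open>v\<close>; otherwise the \<open>T2\<close> component makes
  \<open>g u\<close> a multiple of \<open>g v\<close>.\<close>

lemma line_eq_if_meet:
  assumes u: "u \<in> T1" "u \<noteq> 0" and v: "v \<in> T1" "v \<noteq> 0"
    and x: "x \<in> line u" "x \<in> line v" "x \<noteq> 0"
  shows "line u = line v"
proof -
  obtain a b where ab: "x = sc a u + sc b (g u)"
    using x(1) unfolding mem_line_iff by blast
  obtain c d where cd: "x = sc c v + sc d (g v)"
    using x(2) unfolding mem_line_iff by blast
  have mem: "sc a u \<in> T1" "sc b (g u) \<in> T2"
    using u vs.subspace_scale[OF subspace1] vs.subspace_scale[OF subspace2] g_mem by auto
  have eq: "sc a u = sc c v" "sc b (g u) = sc d (g v)"
    using line_components[OF v(1) mem, of c d] ab cd by auto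
  have gnz: "g u \<noteq> 0" "g v \<noteq> 0" using u v g_eq_0_iff by auto
  have *: "line u = line v" if "u = sc e v" for e
    using that line_scale[OF v(1), of e] u(2) by (cases "e = 0") auto
  show ?thesis
  proof (cases "a = 0")
    case False
    then have "u = sc (inverse a) (sc a u)" by simp
    then show ?thesis using eq(1) * by (metis vs.scale_scale)
  next
    case True
    then have "b \<noteq> 0" using ab x(3) by auto
    then have "g u = sc (inverse b) (sc b (g u))" by simp
    then have gu: "g u = sc (inverse b * d) (g v)" using eq(2) by simp
    \<comment> \<open>The factor between \<open>g u\<close> and \<open>g v\<close> has a preimage
      under \<open>\<tau>\<close>, which turns proportionality of the images into proportionality of
      \<open>u\<close> and \<open>v\<close>.\<close>
    obtain e where "\<tau> e = inverse b * d" using \<tau>_surj by blast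
    then have "g u = g (sc e v)" using gu v(1) g_scale by simp
    then have "u = sc e v"
      using g_inj u v vs.subspace_scale[OF subspace1] by (auto dest: inj_onD)
    then show ?thesis by (rule *)
  qed
qed

lemma kdim_line:
  assumes u: "u \<in> T1" "u \<noteq> 0"
  shows "kdim (line u) = 2"
proof (rule kdim_eqI[OF ksub_line[OF u(1)]])
  let ?h = "\<lambda>(a, b). sc a u + sc b (g u)"
  have mem: "sc a u \<in> T1" "sc b (g u) \<in> T2" for a b
    using u vs.subspace_scale[OF subspace1] vs.subspace_scale[OF subspace2] g_mem by auto
  have "g u \<noteq> 0" using u g_eq_0_iff by auto
  then have "inj ?h"
    using u line_components[OF u(1) mem]
    by (auto simp: inj_on_def)
  moreover have "line u = range ?h" by (simp add: set_eq_iff mem_line_iff image_iff)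
  ultimately have "card (line u) = CARD('k \<times> 'k)" by (simp add: card_image)
  then show "card (line u) = CARD('k) ^ 2"
    by (simp add: power2_eq_square)
qed

lemma card_span_singleton:
  "u \<noteq> 0 \<Longrightarrow> card (vs.span {u :: 'k vect}) = CARD('k)"
  by (auto simp: vs.span_singleton inj_on_def vs.scale_cancel_right intro!: card_image)

text \<open>The \<open>T1\<close> component of a vector on the line is a multiple of
  \<open>u\<close>. Hence the intersection is the graph over a single point and has
  \<open>q ^ t\<close> vectors, which makes the rank on the line equal to \<open>t\<close>.\<close>

lemma U_inter_line:
  assumes u: "u \<in> T1" "u \<noteq> 0"
  shows "U \<inter> line u = (\<lambda>x. x + g x) ` vs.span {u}"
proof
  show "(\<lambda>x. x + g x) ` vs.span {u} \<subseteq> U \<inter> line u"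
    using u vs.subspace_scale[OF subspace1] g_scale
    by (auto simp: U_def vs.span_singleton mem_line_iff) blast
  show "U \<inter> line u \<subseteq> (\<lambda>x. x + g x) ` vs.span {u}"
  proof
    fix v assume "v \<in> U \<inter> line u"
    then obtain x a b where x: "x \<in> T1" "v = x + g x" "v = sc a u + sc b (g u)"
      by (auto simp: U_def mem_line_iff)
    then have "x = sc a u" using line_components(1)[OF u(1) x(1) g_mem[OF x(1)], of a b] x(2,3) by simp
    then show "v \<in> (\<lambda>x. x + g x) ` vs.span {u}"
      using x(2) by (auto simp: vs.span_singleton)
  qed
qed

lemma linear_set_line:
  assumes u: "u \<in> T1" "u \<noteq> 0"
  shows "linear_set q (line u) t {P \<in> linset U. P \<subseteq> line u}"
  unfolding linear_set_def
proof (intro exI[of _ "U \<inter> line u"] conjI)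
  show sub: "fqsub q (U \<inter> line u)"
    using fqsub_U vs.subspace_0[OF subspace_line] vs.subspace_add[OF subspace_line]
      vs.subspace_scale[OF subspace_line] by (auto simp: fqsub_def)
  have "vs.span {u} \<subseteq> T1" using u subspace1 by (simp add: vs.span_minimal)
  then have "card (U \<inter> line u) = CARD('k)"
    unfolding U_inter_line[OF u]
    using card_image[OF inj_on_subset[OF inj_graph]] card_span_singleton[OF u(2)] by metis
  then have "card (U \<inter> line u) = card (Fq q :: 'k set) ^ t"
    by (simp add: card_Fq card_K)
  then show "fqdim q (U \<inter> line u) = t"
    using fqdim_eqI[OF subfield_Fq sub] U_subset_vecs by blast
  \<comment> \<open>A point lies on the line exactly if a generator does, so the points of the
    linear set on the line are those generated by \<open>U \<inter> line u\<close>.\<close>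
  have "vs.span {x} \<subseteq> line u \<longleftrightarrow> x \<in> line u" for x
    using vs.span_minimal[OF _ subspace_line, of "{x}" u] vs.span_base[of x "{x}"] by auto
  then show "{P \<in> linset U. P \<subseteq> line u} = linset (U \<inter> line u)"
    unfolding linset_def kspan_eq_span by auto
qed simp

lemma line_inter_T1:
  assumes u: "u \<in> T1" "u \<noteq> 0"
  shows "line u \<inter> T1 = vs.span {u}"
proof
  show "vs.span {u} \<subseteq> line u \<inter> T1"
    using u subspace1 unfolding line_def kspan_eq_span
    by (intro Int_greatest vs.span_mono vs.span_minimal) simp_all
  show "line u \<inter> T1 \<subseteq> vs.span {u}"
  proof
    fix x assume x: "x \<in> line u \<inter> T1"
    then obtain a b where "x = sc a u + sc b (g u)" using mem_line_iff by blast
    then have "x = sc a u" using line_components(1)[OF u(1) _ zero_mem(2), of x a b] x by simp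
    then show "x \<in> vs.span {u}" unfolding vs.span_singleton by blast
  qed
qed

section \<open>Counting the lines, and determining the transversal spaces\<close>

lemma finite_T1: "finite T1"
  using ksub_finite[OF ksub1] .

lemma finite_lines: "finite lines"
  unfolding lines_def using finite_T1 by auto

lemma lines_disjoint:
  assumes "l1 \<in> lines" "l2 \<in> lines" "l1 \<noteq> l2"
  shows "l1 \<inter> l2 = {0}"
  using assms line_eq_if_meet vs.subspace_0[OF subspace_line] unfolding lines_def by blast

text \<open>Every nonzero vector of \<open>T1\<close> is on exactly one line, and each line meets
  \<open>T1\<close> in one point, that is in \<open>CARD('k) - 1\<close> nonzero vectors.\<close>

lemma card_lines_mult: "card lines * (CARD('k) - 1) = CARD('k) ^ n - 1"
proof -
  have "T1 - {0} = (\<Union>l\<in>lines. l \<inter> T1 - {0})"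
  proof -
    have "u \<in> line u" for u
      unfolding line_def kspan_eq_span by (simp add: vs.span_base)
    then show ?thesis unfolding lines_def by blast
  qed
  then have "card (T1 - {0}) = (\<Sum>l\<in>lines. card (l \<inter> T1 - {0}))"
    using finite_lines finite_T1 lines_disjoint
    by (subst card_UN_disjoint[symmetric]) auto
  also have "\<dots> = (\<Sum>l\<in>lines. CARD('k) - 1)"
  proof (rule sum.cong[OF refl])
    fix l assume "l \<in> lines"
    then obtain u where u: "u \<in> T1" "u \<noteq> 0" "l = line u" by (auto simp: lines_def)
    then have "l \<inter> T1 - {0} = vs.span {u} - {0}" using line_inter_T1 by simp
    then show "card (l \<inter> T1 - {0}) = CARD('k) - 1"
      using card_span_singleton[OF u(2)] by (simp add: vs.span_zero)
  qed
  finally show ?thesis using zero_mem finite_T1 by (simp add: card_T)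
qed

lemma CARD_ge: "2 \<le> CARD('k)"
proof -
  have "card {0, 1 :: 'k} \<le> CARD('k)" by (intro card_mono) auto
  then show ?thesis by simp
qed

lemma card_lines: "card lines = (q ^ (n * t) - 1) div (q ^ t - 1)"
proof -
  have "q ^ (n * t) - 1 = card lines * (q ^ t - 1)"
    using card_lines_mult by (simp add: card_K mult.commute[of n t] power_mult)
  moreover have "q ^ t - 1 \<noteq> 0"
    using CARD_ge by (simp add: card_K)
  ultimately show ?thesis by simp
qed

text \<open>A transversal space has as many points as there are lines, so each of its points lies on
  one of the lines.\<close>

lemma transversal_covered:
  assumes T: "ksub N T" "kdim T = n" and meet: "\<forall>l\<in>lines. l \<inter> T \<noteq> {0}"
  shows "T - {0} \<subseteq> \<Union>lines"
proof -
  have fin: "finite T" using ksub_finite[OF T(1)] .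
  have sub: "vs.subspace T" using T by (simp add: ksub_iff)
  have ge: "CARD('k) - 1 \<le> card (l \<inter> T - {0})" if l: "l \<in> lines" for l
  proof -
    have sl: "vs.subspace (l \<inter> T)"
      using l sub subspace_line vs.subspace_inter by (auto simp: lines_def)
    then have "0 \<in> l \<inter> T" using vs.subspace_0 by blast
    then obtain v where v: "v \<in> l \<inter> T" "v \<noteq> 0" using meet l by blast
    have "vs.span {v} - {0} \<subseteq> l \<inter> T - {0}"
      using vs.span_minimal[OF _ sl, of "{v}"] v by auto
    then have "card (vs.span {v} - {0}) \<le> card (l \<inter> T - {0})"
      using fin by (intro card_mono) auto
    then show ?thesis using card_span_singleton[OF v(2)] by (simp add: vs.span_zero)
  qed
  have "CARD('k) ^ n - 1 = (\<Sum>l\<in>lines. CARD('k) - 1)"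
    using card_lines_mult by simp
  also have "\<dots> \<le> (\<Sum>l\<in>lines. card (l \<inter> T - {0}))"
    by (rule sum_mono) (rule ge)
  also have "\<dots> = card (\<Union>l\<in>lines. l \<inter> T - {0})"
    using finite_lines fin lines_disjoint by (subst card_UN_disjoint) auto
  finally have "card (T - {0}) \<le> card (\<Union>l\<in>lines. l \<inter> T - {0})"
    using card_ksub[OF T(1)] T(2) vs.subspace_0[OF sub] fin by simp
  \<comment> \<open>The left side is a subset of the finite set on the right and has at least as
    many elements.\<close>
  then have "(\<Union>l\<in>lines. l \<inter> T - {0}) = T - {0}"
    using fin by (intro card_subset_eq card_seteq) auto
  then show ?thesis by blast
qed

text \<open>Every vector of \<open>T\<close> is on a line, so its \<open>T2\<close> part is a
  multiple of the image of its \<open>T1\<close> part whenever the latter is nonzero. This is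
  applied to all \<open>sc s (x + y) + v\<close>, where \<open>v\<close> in \<open>T\<close> is on
  the line of some \<open>w\<close> independent of \<open>x\<close>. Comparing coefficients makes
  \<open>v\<close> zero or \<open>\<tau>\<close> the identity.\<close>

lemma transversal_no_mixed_vector:
  assumes T: "ksub N T" "kdim T = n" "T \<subseteq> \<Lambda>" and meet: "\<forall>l\<in>lines. l \<inter> T \<noteq> {0}"
    and xy: "x \<in> T1" "y \<in> T2" "x + y \<in> T"
  shows "x = 0 \<or> y = 0"
proof (rule ccontr)
  assume "\<not> ?thesis"
  then have nz: "x \<noteq> 0" "y \<noteq> 0" by auto
  have sub: "vs.subspace T" using T by (simp add: ksub_iff)
  have cover: "\<exists>z\<in>T1. z \<noteq> 0 \<and> (\<exists>a b. v = sc a z \<and> w = sc b (g z))"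
    if vw: "v \<in> T1" "w \<in> T2" "v + w \<in> T" "v + w \<noteq> 0" for v w
  proof -
    have "v + w \<in> \<Union>lines" using transversal_covered[OF T(1,2) meet] vw(3,4) by auto
    then obtain z where z: "z \<in> T1" "z \<noteq> 0" "v + w \<in> line z" by (auto simp: lines_def)
    then obtain a b where "v + w = sc a z + sc b (g z)" by (auto simp: mem_line_iff)
    then show ?thesis using line_components[OF z(1) vw(1,2)] z by blast
  qed
  have sum_nz: "v + w \<noteq> 0" if "v \<in> T1" "w \<in> T2" "v \<noteq> 0" for v w
    using decomposition_unique(1)[of v 0 w 0] that zero_mem by auto
  obtain z a b where z: "z \<in> T1" "z \<noteq> 0" "x = sc a z" "y = sc b (g z)"
    using cover[OF xy sum_nz[OF xy(1,2) nz(1)]] by blast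
  have a0: "a \<noteq> 0" and "b \<noteq> 0" using z nz by auto
  \<comment> \<open>From \<open>x = sc a z\<close> it follows that \<open>g x\<close> is
    \<open>\<tau> a\<close> times \<open>g z\<close>, so \<open>\<beta>\<close> is the factor from
    \<open>g x\<close> to \<open>y\<close>.\<close>
  define \<beta> where "\<beta> = b / \<tau> a"
  have \<beta>: "\<beta> \<noteq> 0" "y = sc \<beta> (g x)"
    using z a0 \<open>b \<noteq> 0\<close> \<tau>_eq_0_iff by (auto simp: \<beta>_def g_scale)
  \<comment> \<open>Here \<open>n \<ge> 2\<close> provides a second direction \<open>w\<close> in
    \<open>T1\<close>.\<close>
  have "card (vs.span {x}) < card T1"
    using card_span_singleton[OF nz(1)] CARD_ge n_ge power_strict_increasing[of 1 n "CARD('k)"]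
    by (simp add: card_T)
  then have "vs.span {x} \<noteq> T1" by auto
  moreover have "vs.span {x} \<subseteq> T1" using xy subspace1 by (simp add: vs.span_minimal)
  ultimately obtain w where w: "w \<in> T1" "w \<notin> vs.span {x}" by blast
  then have w0: "w \<noteq> 0" using vs.span_zero by auto
  have indep: "c = 0 \<and> d = 0" if "sc c x + sc d w = 0" for c d
  proof -
    have "d = 0"
    proof (rule ccontr)
      assume d: "d \<noteq> 0"
      have "sc d w = sc (- c) x" using that by (simp add: eq_neg_iff_add_eq_0 add.commute)
      then have "w = sc (- c / d) x" using d
        by (metis (no_types, opaque_lifting) vs.scale_one vs.scale_scale divide_inverse
            left_inverse mult.commute)
      then show False using w(2) unfolding vs.span_singleton by blast
    qed
    then show ?thesis using that nz by simp
  qed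
  have g_indep: "c = 0 \<and> d = 0" if "sc c (g x) + sc d (g w) = 0" for c d
  proof -
    \<comment> \<open>Surjectivity of \<open>\<tau>\<close> writes the relation between
      \<open>g x\<close> and \<open>g w\<close> as the image of a relation between \<open>x\<close>
      and \<open>w\<close>.\<close>
    obtain c' d' where cd: "\<tau> c' = c" "\<tau> d' = d" using \<tau>_surj by metis
    have mem: "sc c' x \<in> T1" "sc d' w \<in> T1"
      using xy w vs.subspace_scale[OF subspace1] by auto
    have "g (sc c' x + sc d' w) = 0"
      using that cd mem xy w by (simp add: g_add g_scale)
    then have "sc c' x + sc d' w = 0"
      using g_eq_0_iff vs.subspace_add[OF subspace1] mem by blast
    then show ?thesis using indep cd \<tau>_0 by blast
  qed
  have "line w \<inter> T \<noteq> {0}" using meet w w0 by (auto simp: lines_def)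
  moreover have "0 \<in> line w \<inter> T"
    using vs.subspace_0[OF subspace_line] vs.subspace_0[OF sub] by auto
  ultimately obtain v where v: "v \<in> line w" "v \<in> T" "v \<noteq> 0" by blast
  \<comment> \<open>From here on \<open>a\<close> and \<open>b\<close> are the coefficients of
    \<open>v\<close>; the earlier pair survives only in \<open>\<beta>\<close>.\<close>
  then obtain a b where ab: "v = sc a w + sc b (g w)" by (auto simp: mem_line_iff)
  \<comment> \<open>\<open>\<kappa>\<close> is the factor from \<open>g ?X\<close> to
    \<open>?Y\<close>; it may depend on \<open>s\<close>. The two equations are the coefficients of
    \<open>g x\<close> and \<open>g w\<close>.\<close>
  have key: "\<exists>\<kappa>. s * \<beta> = \<kappa> * \<tau> s \<and> b = \<kappa> * \<tau> a" if s: "s \<noteq> 0 \<or> a \<noteq> 0" for s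
  proof -
    let ?X = "sc s x + sc a w" and ?Y = "sc (s * \<beta>) (g x) + sc b (g w)"
    have mem: "sc s x \<in> T1" "sc a w \<in> T1" "?X \<in> T1" "?Y \<in> T2"
      using xy w g_mem by (auto intro!: vs.subspace_add[OF subspace1] vs.subspace_add[OF subspace2]
          vs.subspace_scale[OF subspace1] vs.subspace_scale[OF subspace2])
    have X0: "?X \<noteq> 0" using indep s by blast
    have "?X + ?Y = sc s (x + y) + v"
      by (simp add: ab \<beta>(2) vs.scale_right_distrib algebra_simps)
    then have "?X + ?Y \<in> T"
      using vs.subspace_add[OF sub vs.subspace_scale[OF sub xy(3)] v(2)] by simp
    then obtain z \<alpha> \<gamma> where z: "z \<in> T1" "?X = sc \<alpha> z" "?Y = sc \<gamma> (g z)"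
      using cover[OF mem(3,4)] sum_nz[OF mem(3,4) X0] by blast
    have \<alpha>: "\<alpha> \<noteq> 0" using z(2) X0 by auto
    have "g ?X = sc (\<tau> \<alpha>) (g z)" using z g_scale by simp
    then have gz: "?Y = sc (\<gamma> / \<tau> \<alpha>) (g ?X)"
      using z(3) \<alpha> \<tau>_eq_0_iff by simp
    define \<kappa> where "\<kappa> = \<gamma> / \<tau> \<alpha>"
    have "g ?X = sc (\<tau> s) (g x) + sc (\<tau> a) (g w)"
      using mem xy w by (simp add: g_add g_scale)
    then have "?Y = sc (\<kappa> * \<tau> s) (g x) + sc (\<kappa> * \<tau> a) (g w)"
      using gz by (simp add: \<kappa>_def vs.scale_right_distrib)
    then have "sc (s * \<beta> - \<kappa> * \<tau> s) (g x) + sc (b - \<kappa> * \<tau> a) (g w) = 0"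
      by (simp add: vs.scale_left_diff_distrib algebra_simps)
    then have "s * \<beta> - \<kappa> * \<tau> s = 0 \<and> b - \<kappa> * \<tau> a = 0" by (rule g_indep)
    then show ?thesis by (intro exI[of _ \<kappa>]) simp
  qed
  show False
  proof (cases "a = 0")
    case True
    \<comment> \<open>With \<open>a = 0\<close> the second equation reads
      \<open>b = \<kappa> * \<tau> 0\<close>, so \<open>v\<close> would vanish.\<close>
    then have "b = 0" using key[of 1] \<tau>_0 by auto
    with True v(3) ab show False by simp
  next
    case False
    then have \<tau>a: "\<tau> a \<noteq> 0" using \<tau>_eq_0_iff by simp
    have \<tau>1: "\<tau> 1 = 1"
      using mem_Fq_iff[of 1] subfieldD[OF subfield_Fq] by simp
    \<comment> \<open>The choice \<open>s = 1\<close> gives \<open>\<kappa> = \<beta>\<close>. As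
      \<open>b = \<kappa> * \<tau> a\<close> with \<open>\<tau> a\<close> nonzero, the same
      \<open>\<kappa>\<close> then serves every \<open>s\<close>, and the first equation becomes
      \<open>\<tau> s = s\<close>.\<close>
    have b: "b = \<beta> * \<tau> a" using key[of 1] False \<tau>1 by auto
    have "\<tau> s = s" for s
    proof -
      obtain \<kappa> where \<kappa>: "s * \<beta> = \<kappa> * \<tau> s" "b = \<kappa> * \<tau> a" using key[of s] False by blast
      then have "\<kappa> = \<beta>" using b \<tau>a by simp
      with \<kappa>(1) \<beta>(1) show ?thesis by (simp add: mult.commute)
    qed
    then show False using \<tau>_nontrivial by blast
  qed
qed

text \<open>Without mixed vectors \<open>T\<close> lies in the union of \<open>T1\<close> and
  \<open>T2\<close>. Nonzero vectors from both parts would add up to a mixed one, so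
  \<open>T\<close> lies in one of them and equals it by cardinality.\<close>

lemma transversal_cases:
  assumes T: "ksub N T" "kdim T = n" "T \<subseteq> \<Lambda>" and meet: "\<forall>l\<in>lines. l \<inter> T \<noteq> {0}"
  shows "T = T1 \<or> T = T2"
proof -
  have sub: "vs.subspace T" using T by (simp add: ksub_iff)
  have "T \<subseteq> T1 \<union> T2"
  proof
    fix v assume v: "v \<in> T"
    then obtain x y where xy: "x \<in> T1" "y \<in> T2" "v = x + y" using T(3) by (auto simp: \<Lambda>_eq)
    then show "v \<in> T1 \<union> T2"
      using transversal_no_mixed_vector[OF T meet xy(1,2)] v by auto
  qed
  moreover have "x = 0 \<or> y = 0" if "x \<in> T \<inter> T1" "y \<in> T \<inter> T2" for x y
    using transversal_no_mixed_vector[OF T meet, of x y] vs.subspace_add[OF sub] that by auto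
  ultimately have "T \<subseteq> T1 \<or> T \<subseteq> T2" using zero_mem by blast
  moreover have "card T = CARD('k) ^ n" using card_ksub[OF T(1)] T(2) by simp
  ultimately show ?thesis
    using card_subset_eq ksub_finite[OF ksub1] ksub_finite[OF ksub2] card_T by metis
qed

lemma transversal_T:
  assumes "T = T1 \<or> T = T2"
  shows "\<forall>P\<in>linset U. \<not> P \<subseteq> T" "\<forall>l\<in>lines. l \<inter> T \<noteq> {0}"
proof -
  show "\<forall>P\<in>linset U. \<not> P \<subseteq> T"
  proof
    fix P assume "P \<in> linset U"
    then obtain u where u: "u \<in> T1" "u \<noteq> 0" "P = vs.span {u + g u}"
      by (auto simp: linset_U kspan_eq_span)
    show "\<not> P \<subseteq> T"
    proof
      assume "P \<subseteq> T"
      then have "u + g u \<in> T" using u(3) vs.span_base[of "u + g u"] by auto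
      then show False
        using assms decomposition_unique(1)[OF u(1) zero_mem(1) g_mem[OF u(1)], of "u + g u"]
          decomposition_unique(2)[OF u(1) _ g_mem[OF u(1)] zero_mem(2), of "u + g u"]
          u g_eq_0_iff by auto
    qed
  qed
  show "\<forall>l\<in>lines. l \<inter> T \<noteq> {0}"
  proof
    fix l assume "l \<in> lines"
    then obtain u where u: "u \<in> T1" "u \<noteq> 0" "l = line u" by (auto simp: lines_def)
    have "u \<in> l" "g u \<in> l" unfolding u(3) line_def kspan_eq_span by (simp_all add: vs.span_base)
    moreover have "g u \<in> T2" "g u \<noteq> 0" using u g_mem g_eq_0_iff by auto
    ultimately show "l \<inter> T \<noteq> {0}" using assms u by blast
  qed
qed

lemma T_neq: "T1 \<noteq> T2"
proof
  assume "T1 = T2"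
  then have "card T1 = 1" using disj by simp
  then show False using card_T CARD_ge n_ge by simp
qed

theorem pseudoregulus_type_U: "pseudoregulus_type q N t n \<Lambda> (linset U) T1 T2"
  unfolding pseudoregulus_type_def
proof (intro conjI exI[of _ lines] ballI impI)
  show "scattered_linear_set q \<Lambda> (t * n) (linset U)" by (rule scattered_linear_set_U)
  show "finite lines" by (rule finite_lines)
  show "card lines = (q ^ (n * t) - 1) div (q ^ t - 1)" by (rule card_lines)
  show "T1 \<noteq> T2" by (rule T_neq)
  show "{T. ksub N T \<and> T \<subseteq> \<Lambda> \<and> kdim T = n \<and> (\<forall>P\<in>linset U. \<not> P \<subseteq> T) \<and> (\<forall>l\<in>lines. l \<inter> T \<noteq> {0})}
      = {T1, T2}"
    using transversal_cases transversal_T ksub1 ksub2 kdim1 kdim2 subset_\<Lambda> by auto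
next
  fix l assume "l \<in> lines"
  then obtain u where u: "u \<in> T1" "u \<noteq> 0" "l = line u" by (auto simp: lines_def)
  then show "ksub N l" "l \<subseteq> \<Lambda>" "kdim l = 2" "linear_set q l t {P \<in> linset U. P \<subseteq> l}"
    using ksub_line line_subset kdim_line linear_set_line by auto
next
  fix l1 l2 assume "l1 \<in> lines" "l2 \<in> lines" "l1 \<noteq> l2"
  then show "l1 \<inter> l2 = {0}" by (rule lines_disjoint)
qed

end

section \<open>Director spaces and projection\<close>

text \<open>With the span parametrised by the product of the subspaces, directness of the sum is
  injectivity of the summation map, which a count can decide.\<close>

lemma span_UN_subspaces:
  assumes J: "finite J" and W: "\<And>j. j \<in> J \<Longrightarrow> vs.subspace (W j :: 'k::field vect set)"
  shows "vs.span (\<Union>j\<in>J. W j) = (\<lambda>x. \<Sum>j\<in>J. x j) ` (PiE J W)"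
proof
  let ?R = "(\<lambda>x. \<Sum>j\<in>J. x j) ` (PiE J W)"
  have memI: "(\<Sum>j\<in>J. x j) \<in> ?R" if "\<And>j. j \<in> J \<Longrightarrow> x j \<in> W j" for x
    by (rule image_eqI[of _ _ "restrict x J"]) (use that in \<open>auto intro!: sum.cong\<close>)
  show "?R \<subseteq> vs.span (\<Union>j\<in>J. W j)"
  proof (rule image_subsetI)
    fix x assume "x \<in> PiE J W"
    then have "x j \<in> (\<Union>j\<in>J. W j)" if "j \<in> J" for j
      using that by (blast dest: PiE_mem)
    then show "(\<Sum>j\<in>J. x j) \<in> vs.span (\<Union>j\<in>J. W j)"
      by (intro vs.span_sum vs.span_base)
  qed
  show "vs.span (\<Union>j\<in>J. W j) \<subseteq> ?R"
  proof (rule vs.span_minimal)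
    show "(\<Union>j\<in>J. W j) \<subseteq> ?R"
    proof
      fix w assume "w \<in> (\<Union>j\<in>J. W j)"
      then obtain j where j: "j \<in> J" "w \<in> W j" by blast
      have "(\<Sum>i\<in>J. if i = j then w else 0) \<in> ?R"
        by (rule memI) (use j vs.subspace_0[OF W] in auto)
      then show "w \<in> ?R" using J j by (simp only: sum.delta if_True)
    qed
    show "vs.subspace ?R"
    proof (rule vs.subspaceI)
      have "(\<Sum>j\<in>J. 0) \<in> ?R"
        by (rule memI) (rule vs.subspace_0[OF W])
      then show "0 \<in> ?R" by (simp only: sum.neutral_const)
    next
      fix u v assume "u \<in> ?R" "v \<in> ?R"
      then obtain x y where x: "x \<in> PiE J W" "u = (\<Sum>j\<in>J. x j)" and y: "y \<in> PiE J W" "v = (\<Sum>j\<in>J. y j)"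
        by blast
      have "(\<Sum>j\<in>J. x j + y j) \<in> ?R"
        by (rule memI) (use x(1) y(1) in \<open>auto intro!: vs.subspace_add[OF W]\<close>)
      then show "u + v \<in> ?R" by (simp only: x y sum.distrib)
    next
      fix c u assume "u \<in> ?R"
      then obtain x where x: "x \<in> PiE J W" "u = (\<Sum>j\<in>J. x j)"
        by blast
      have "(\<Sum>j\<in>J. sc c (x j)) \<in> ?R"
        by (rule memI) (use x(1) in \<open>auto intro!: vs.subspace_scale[OF W]\<close>)
      then show "sc c u \<in> ?R" by (simp only: x vs.scale_sum_right)
    qed
  qed
qed

text \<open>Projection of a point from \<open>A\<close> onto \<open>B\<close> on the level of
  vectors: modulo \<open>A\<close>, the generator \<open>a + b\<close> is \<open>b\<close>.\<close>

lemma span_projection: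
  assumes A: "vs.subspace A" and B: "vs.subspace B" and AB: "A \<inter> B = {0}"
    and a: "a \<in> A" and b: "b \<in> B"
  shows "vs.span (A \<union> vs.span {a + b}) \<inter> B = vs.span {b}"
proof
  show "vs.span (A \<union> vs.span {a + b}) \<inter> B \<subseteq> vs.span {b}"
  proof
    fix p assume p: "p \<in> vs.span (A \<union> vs.span {a + b}) \<inter> B"
    then have "p \<in> {x + y | x y. x \<in> A \<and> y \<in> vs.span {a + b}}"
      using span_Un_subspace[OF A vs.subspace_span] by simp
    then obtain x c where x: "x \<in> A" "p = x + sc c (a + b)"
      unfolding vs.span_singleton by blast
    have "p - sc c b = x + sc c a"
      by (simp add: x vs.scale_right_distrib)
    moreover have "x + sc c a \<in> A"
      using x(1) a A by (intro vs.subspace_add vs.subspace_scale)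
    moreover have "p - sc c b \<in> B"
      using p b B by (intro vs.subspace_diff vs.subspace_scale) auto
    ultimately have "p - sc c b \<in> A \<inter> B" by simp
    then have "p = sc c b" unfolding AB by simp
    then show "p \<in> vs.span {b}" unfolding vs.span_singleton by blast
  qed
  have "b = - a + (a + b)" by simp
  also have "\<dots> \<in> vs.span (A \<union> vs.span {a + b})"
    using a by (intro vs.span_add vs.span_neg vs.span_base) (auto simp: vs.span_base)
  finally have "b \<in> vs.span (A \<union> vs.span {a + b})" .
  then show "vs.span {b} \<subseteq> vs.span (A \<union> vs.span {a + b}) \<inter> B"
    using b B by (intro Int_greatest vs.span_minimal) auto
qed

section \<open>Semilinear maps, their powers and their effect on subspaces\<close>

lemma semilinear_on_add:
  "semilinear_on A B f \<sigma> \<Longrightarrow> u \<in> A \<Longrightarrow> v \<in> A \<Longrightarrow> f (u + v) = f u + f v"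
  and semilinear_on_scale:
  "semilinear_on A B f \<sigma> \<Longrightarrow> u \<in> A \<Longrightarrow> f (sc c u) = sc (\<sigma> c) (f u)"
  and semilinear_on_image: "semilinear_on A B f \<sigma> \<Longrightarrow> f ` A = B"
  and semilinear_on_inj: "semilinear_on A B f \<sigma> \<Longrightarrow> inj_on f A"
  and semilinear_on_aut: "semilinear_on A B f \<sigma> \<Longrightarrow> field_aut \<sigma>"
  by (simp_all add: semilinear_on_def bij_betw_def)

lemma field_aut_0: "field_aut \<sigma> \<Longrightarrow> \<sigma> 0 = 0"
  and field_aut_1: "field_aut \<sigma> \<Longrightarrow> \<sigma> 1 = 1"
  using subfieldD(1,2)[OF subfield_fixed_set, of \<sigma>] by simp_all

lemma semilinear_on_zero:
  assumes "semilinear_on A B f \<sigma>" "0 \<in> A"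
  shows "f 0 = 0"
  using semilinear_on_scale[OF assms, of 0] field_aut_0[OF semilinear_on_aut[OF assms(1)]] by simp

lemma semilinear_on_sum:
  assumes f: "semilinear_on A B f \<sigma>" and A: "vs.subspace A" and x: "\<And>i. i \<in> I \<Longrightarrow> x i \<in> A"
  shows "f (\<Sum>i\<in>I. x i) = (\<Sum>i\<in>I. f (x i))"
  using x
proof (induction I rule: infinite_finite_induct)
  case (insert i I)
  then have "(\<Sum>i\<in>I. x i) \<in> A" by (intro vs.subspace_sum[OF A]) simp
  then have "f (x i + (\<Sum>i\<in>I. x i)) = f (x i) + f (\<Sum>i\<in>I. x i)"
    using insert.prems by (intro semilinear_on_add[OF f]) simp_all
  also have "f (\<Sum>i\<in>I. x i) = (\<Sum>i\<in>I. f (x i))"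
    using insert.prems by (intro insert.IH) simp
  finally show ?case unfolding sum.insert[OF insert.hyps] .
qed (use semilinear_on_zero[OF f vs.subspace_0[OF A]] in simp_all)

lemma semilinear_on_comp:
  assumes f: "semilinear_on A B f \<sigma>" and g: "semilinear_on B C g \<tau>"
  shows "semilinear_on A C (g \<circ> f) (\<tau> \<circ> \<sigma>)"
proof -
  have "f u \<in> B" if "u \<in> A" for u using semilinear_on_image[OF f] that by blast
  moreover have "bij_betw (g \<circ> f) A C"
    using f g by (auto simp: semilinear_on_def intro: bij_betw_trans)
  moreover have "field_aut (\<tau> \<circ> \<sigma>)"
    using semilinear_on_aut[OF f] semilinear_on_aut[OF g] by (auto simp: field_aut_def intro: bij_comp)
  ultimately show ?thesis
    unfolding semilinear_on_def
    by (simp add: semilinear_on_add[OF f] semilinear_on_add[OF g]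
        semilinear_on_scale[OF f] semilinear_on_scale[OF g])
qed

lemma semilinear_on_funpow:
  assumes "semilinear_on A A f \<sigma>"
  shows "semilinear_on A A (f ^^ k) (\<sigma> ^^ k)"
proof (induction k)
  case 0
  show ?case by (simp add: semilinear_on_def field_aut_def bij_betw_def)
next
  case (Suc k)
  then show ?case using semilinear_on_comp[OF Suc assms] by (simp add: o_def)
qed

lemma semilinear_on_subset:
  assumes "semilinear_on A B f \<sigma>" "W \<subseteq> A"
  shows "semilinear_on W (f ` W) f \<sigma>"
proof -
  have "u \<in> A" if "u \<in> W" for u using that assms(2) by blast
  moreover have "inj_on f W" using semilinear_on_inj[OF assms(1)] assms(2) by (rule inj_on_subset)
  ultimately show ?thesis
    using assms(1) unfolding semilinear_on_def bij_betw_def by simp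
qed

lemma subspace_semilinear_image:
  assumes f: "semilinear_on A B f \<sigma>" and W: "vs.subspace W" "W \<subseteq> A"
  shows "vs.subspace (f ` W)"
proof -
  note fW = semilinear_on_subset[OF f W(2)]
  show ?thesis
  proof (rule vs.subspaceI)
    show "0 \<in> f ` W"
      using semilinear_on_zero[OF fW vs.subspace_0[OF W(1)]] vs.subspace_0[OF W(1)] by force
  next
    fix x y assume "x \<in> f ` W" "y \<in> f ` W"
    then obtain u v where uv: "u \<in> W" "v \<in> W" "x = f u" "y = f v" by blast
    then have "x + y = f (u + v)" by (simp add: semilinear_on_add[OF fW])
    then show "x + y \<in> f ` W" using vs.subspace_add[OF W(1) uv(1,2)] by simp
  next
    fix c x assume "x \<in> f ` W"
    then obtain u where u: "u \<in> W" "x = f u" by blast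
    \<comment> \<open>Scalars are pulled back through the surjective companion automorphism.\<close>
    obtain d where d: "c = \<sigma> d"
      using semilinear_on_aut[OF f] unfolding field_aut_def bij_def surj_def by blast
    have "sc c x = f (sc d u)" by (simp add: u d semilinear_on_scale[OF fW])
    then show "sc c x \<in> f ` W" using vs.subspace_scale[OF W(1) u(1)] by simp
  qed
qed

lemma ksub_semilinear_image:
  assumes "semilinear_on (vecs N) (vecs N) f \<sigma>" "ksub N W"
  shows "ksub N (f ` W)"
  using subspace_semilinear_image[OF assms(1)] semilinear_on_image[OF assms(1)] assms(2)
  unfolding ksub_iff by blast

text \<open>A semilinear bijection preserves cardinality, and dimension is determined by it.\<close>

lemma kdim_semilinear_image:
  fixes W :: "'k::{finite,field} vect set"
  assumes f: "semilinear_on (vecs N) (vecs N) f \<sigma>" and W: "ksub N W"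
  shows "kdim (f ` W) = kdim W"
proof (rule kdim_eqI[OF ksub_semilinear_image[OF assms]])
  have "card (f ` W) = card W"
    using W by (intro card_image inj_on_subset[OF semilinear_on_inj[OF f]]) (simp add: ksub_iff)
  then show "card (f ` W) = CARD('k) ^ kdim W" using card_ksub[OF W] by simp
qed

lemma funpow_fixed: "f x = x \<Longrightarrow> (f ^^ k) x = x"
  by (induction k) simp_all

text \<open>By Bezout \<open>m * a = t * b + 1\<close>. The power on the left fixes
  \<open>x\<close>, while the one on the right sends \<open>x\<close> to \<open>f x\<close>.\<close>

lemma funpow_coprime_fixed:
  assumes "(f ^^ m) x = x" "(f ^^ t) x = x" "coprime m t" "m \<noteq> 0"
  shows "f x = x"
proof -
  obtain a b where ab: "m * a = t * b + 1"
    using bezout_nat[OF assms(4), of t] assms(3) by (auto simp: coprime_iff_gcd_eq_1)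
  have "(f ^^ (m * a)) x = x"
    using funpow_fixed[where f = "f ^^ m", OF assms(1)] by (simp add: funpow_mult)
  moreover have "(f ^^ (t * b)) x = x"
    using funpow_fixed[where f = "f ^^ t", OF assms(2)] by (simp add: funpow_mult)
  ultimately show ?thesis unfolding ab by simp
qed

text \<open>Here the collineation is represented by a map whose \<open>t\<close>-th power is the
  identity on vectors and not merely on points. Of the subgeometry only the number of fixed vectors
  is recorded, in \<open>card_fixed\<close>.\<close>

locale director_frame =
  fixes q t n N :: nat and \<psi> :: "'k::{finite,field} vect \<Rightarrow> 'k vect"
    and \<sigma> :: "'k \<Rightarrow> 'k" and \<Theta> :: "'k vect set"
  assumes n_ge: "2 \<le> n" and t_ge: "3 \<le> t" and N_eq: "N = t * n"
    and card_K: "CARD('k) = q ^ t"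
    and semilin: "semilinear_on (vecs N) (vecs N) \<psi> \<sigma>"
    and \<psi>_period: "v \<in> vecs N \<Longrightarrow> (\<psi> ^^ t) v = v" and \<sigma>_period: "(\<sigma> ^^ t) c = c"
    and fixed: "{x. \<sigma> x = x} = Fq q"
    and card_fixed: "card {v \<in> vecs N. \<psi> v = v} = card (Fq q :: 'k set) ^ N"
    and director: "director_cond N t n \<psi> \<Theta>"
begin

section \<open>Decomposition into the conjugates of \<open>\<Theta>\<close>, and the vectors fixed
  by \<open>\<psi>\<close>\<close>

definition "Th j = (\<psi> ^^ j) ` \<Theta>"
text \<open>One notion for three spaces: \<open>\<Gamma>\<close> and \<open>\<Lambda>\<close> belong
  to complementary index sets, the whole space to \<open>{..<t}\<close>.\<close>

definition "S J = kspan (\<Union>j\<in>J. Th j)"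

lemma ksub_\<Theta>: "ksub N \<Theta>" and kdim_\<Theta>: "kdim \<Theta> = n"
  and span_\<Theta>: "vs.span (\<Union>j<t. Th j) = vecs N"
  using director by (auto simp: director_cond_def Th_def kspan_eq_span)

lemma \<Theta>_vecs: "u \<in> \<Theta> \<Longrightarrow> u \<in> vecs N"
  using ksub_\<Theta> by (auto simp: ksub_iff)

lemmas semilin_funpow = semilinear_on_funpow[OF semilin]

lemma ksub_Th: "ksub N (Th j)" and kdim_Th: "kdim (Th j) = n"
  and subspace_Th: "vs.subspace (Th j)"
  using ksub_semilinear_image[OF semilin_funpow ksub_\<Theta>, of j]
    kdim_semilinear_image[OF semilin_funpow ksub_\<Theta>, of j] kdim_\<Theta>
  by (auto simp: Th_def ksub_iff)

lemma card_Th: "card (Th j) = CARD('k) ^ n"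
  using card_ksub[OF ksub_Th] kdim_Th by simp

lemma finite_Th: "finite (Th j)"
  by (rule ksub_finite[OF ksub_Th])

lemma S_eq: "finite J \<Longrightarrow> S J = (\<lambda>x. \<Sum>j\<in>J. x j) ` (PiE J Th)"
  unfolding S_def kspan_eq_span by (rule span_UN_subspaces) (simp_all add: subspace_Th)

lemma ksub_S: "ksub N (S J)"
  unfolding S_def kspan_eq_span by (rule ksub_span) (use ksub_Th in \<open>auto simp: ksub_iff\<close>)

lemma subspace_S: "vs.subspace (S J)"
  using ksub_S by (simp add: ksub_iff)

text \<open>The \<open>t\<close> conjugates of \<open>\<Theta>\<close> span a space with as many vectors as their product, so the sum is direct.\<close>

lemma inj_sum: "inj_on (\<lambda>x. \<Sum>j<t. x j) (PiE {..<t} Th)"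
proof (rule eq_card_imp_inj_on)
  show "finite (PiE {..<t} Th)" by (intro finite_PiE) (auto simp: finite_Th)
  have "(\<lambda>x. \<Sum>j<t. x j) ` (PiE {..<t} Th) = vecs N"
    using span_\<Theta> S_eq[of "{..<t}"] by (simp add: S_def kspan_eq_span)
  then show "card ((\<lambda>x. \<Sum>j<t. x j) ` (PiE {..<t} Th)) = card (PiE {..<t} Th)"
    by (simp add: card_vecs card_PiE card_Th N_eq mult.commute power_mult)
qed

lemma sum_unique:
  assumes "\<And>j. j < t \<Longrightarrow> x j \<in> Th j" "\<And>j. j < t \<Longrightarrow> y j \<in> Th j"
    and "(\<Sum>j<t. x j) = (\<Sum>j<t. y j)" "j < t"
  shows "x j = y j"
proof -
  have "restrict x {..<t} = restrict y {..<t}"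
    by (rule inj_onD[OF inj_sum]) (use assms(1-3) in auto)
  then have "restrict x {..<t} j = restrict y {..<t} j" by simp
  then show ?thesis using assms(4) by simp
qed

text \<open>Both families are padded with 0 to all indices below \<open>t\<close>, where the
  decomposition is unique. This yields dimension and disjointness of the spaces
  \<open>S J\<close>.\<close>

lemma sum_unique_subsets:
  assumes J: "J \<subseteq> {..<t}" "J' \<subseteq> {..<t}" and x: "x \<in> PiE J Th" and y: "y \<in> PiE J' Th"
    and eq: "(\<Sum>j\<in>J. x j) = (\<Sum>j\<in>J'. y j)" and j: "j < t"
  shows "(if j \<in> J then x j else 0) = (if j \<in> J' then y j else 0)"
proof (rule sum_unique[where j = j])
  show "(if j \<in> J then x j else 0) \<in> Th j" for j
    using x vs.subspace_0[OF subspace_Th] by auto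
  show "(if j \<in> J' then y j else 0) \<in> Th j" for j
    using y vs.subspace_0[OF subspace_Th] by auto
  have "(\<Sum>j<t. if j \<in> J then x j else 0) = (\<Sum>j\<in>J. x j)"
    using J(1) by (simp add: sum.If_cases Int_absorb1)
  moreover have "(\<Sum>j<t. if j \<in> J' then y j else 0) = (\<Sum>j\<in>J'. y j)"
    using J(2) by (simp add: sum.If_cases Int_absorb1)
  ultimately show "(\<Sum>j<t. if j \<in> J then x j else 0) = (\<Sum>j<t. if j \<in> J' then y j else 0)"
    using eq by simp
qed (rule j)

lemma kdim_S:
  assumes J: "J \<subseteq> {..<t}"
  shows "kdim (S J) = n * card J"
proof (rule kdim_eqI[OF ksub_S])
  have fin: "finite J" using J finite_subset by blast
  have "inj_on (\<lambda>x. \<Sum>j\<in>J. x j) (PiE J Th)"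
  proof (rule inj_onI)
    fix x y assume xy: "x \<in> PiE J Th" "y \<in> PiE J Th" "(\<Sum>j\<in>J. x j) = (\<Sum>j\<in>J. y j)"
    show "x = y"
    proof (rule PiE_ext[OF xy(1,2)])
      fix j assume "j \<in> J"
      then show "x j = y j" using sum_unique_subsets[OF J J xy, of j] J by auto
    qed
  qed
  then have "card (S J) = card (PiE J Th)"
    unfolding S_eq[OF fin] by (rule card_image)
  then show "card (S J) = CARD('k) ^ (n * card J)"
    using fin by (simp add: card_PiE card_Th power_mult)
qed

lemma S_disjoint:
  assumes J: "J \<subseteq> {..<t}" "J' \<subseteq> {..<t}" "J \<inter> J' = {}"
  shows "S J \<inter> S J' = {0}"
proof
  show "S J \<inter> S J' \<subseteq> {0}"
  proof
    fix v assume v: "v \<in> S J \<inter> S J'"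
    have fin: "finite J" "finite J'" using J finite_subset by blast+
    obtain x where x: "x \<in> PiE J Th" "v = (\<Sum>j\<in>J. x j)"
      using v unfolding S_eq[OF fin(1)] by blast
    obtain y where y: "y \<in> PiE J' Th" "v = (\<Sum>j\<in>J'. y j)"
      using v unfolding S_eq[OF fin(2)] by blast
    have "x j = 0" if j: "j \<in> J" for j
    proof -
      have "j < t" "j \<notin> J'" using J j by auto
      then show ?thesis
        using sum_unique_subsets[OF J(1,2) x(1) y(1), of j] x(2) y(2) j by simp
    qed
    then show "v \<in> {0}" by (simp add: x(2))
  qed
  show "{0} \<subseteq> S J \<inter> S J'" using vs.subspace_0[OF subspace_S] by auto
qed

lemma \<psi>_zero: "(\<psi> ^^ j) 0 = 0"
  using semilinear_on_zero[OF semilin_funpow] vs.subspace_0[OF subspace_vecs] .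

lemma \<psi>_eq_0_iff: "u \<in> vecs N \<Longrightarrow> (\<psi> ^^ j) u = 0 \<longleftrightarrow> u = 0"
  using semilinear_on_inj[OF semilin_funpow, of j] \<psi>_zero[of j] vs.subspace_0[OF subspace_vecs]
  by (metis inj_onD)

lemma funpow_vecs: "u \<in> vecs N \<Longrightarrow> (\<psi> ^^ j) u \<in> vecs N"
  using semilinear_on_image[OF semilin_funpow, of j] by blast

text \<open>For \<open>J = {..<t}\<close> this is the trace of \<open>u\<close> under the powers of
  \<open>\<psi>\<close>; for smaller \<open>J\<close> it is, when \<open>u\<close> is in
  \<open>\<Theta>\<close>, the part of that trace in \<open>S J\<close>.\<close>

definition "orbit_sum J u = (\<Sum>j\<in>J. (\<psi> ^^ j) u)"

lemma orbit_sum_in_S: "u \<in> \<Theta> \<Longrightarrow> orbit_sum J u \<in> S J"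
  unfolding orbit_sum_def S_def kspan_eq_span Th_def
  by (intro vs.span_sum vs.span_base) blast

text \<open>Applying \<open>\<psi>\<close> shifts the summands by one place, and the last one
  returns to \<open>u\<close> because \<open>\<psi>\<close> has period \<open>t\<close>.\<close>

lemma \<psi>_orbit_sum:
  assumes u: "u \<in> vecs N"
  shows "\<psi> (orbit_sum {..<t} u) = orbit_sum {..<t} u"
proof -
  obtain s where s: "t = Suc s" using t_ge by (cases t) auto
  have "\<psi> (orbit_sum {..<t} u) = (\<Sum>j<t. \<psi> ((\<psi> ^^ j) u))"
    unfolding orbit_sum_def
    by (rule semilinear_on_sum[OF semilin subspace_vecs]) (rule funpow_vecs[OF u])
  also have "\<dots> = (\<Sum>j<s. (\<psi> ^^ Suc j) u) + (\<psi> ^^ t) u"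
    by (simp add: s)
  also have "\<dots> = (\<psi> ^^ 0) u + (\<Sum>j<s. (\<psi> ^^ Suc j) u)"
    using \<psi>_period[OF u] by (simp add: add.commute)
  also have "\<dots> = orbit_sum {..<t} u"
    unfolding orbit_sum_def s by (rule sum.lessThan_Suc_shift[symmetric])
  finally show ?thesis .
qed

text \<open>\<open>\<psi>\<close> permutes the conjugates of \<open>\<Theta>\<close> cyclically. If
  it fixes \<open>v\<close>, uniqueness of the decomposition says that it carries each component of
  \<open>v\<close> to the next, so all of them come from the component in
  \<open>\<Theta>\<close>.\<close>

lemma fixed_vectors: "{v \<in> vecs N. \<psi> v = v} = orbit_sum {..<t} ` \<Theta>"
proof
  show "orbit_sum {..<t} ` \<Theta> \<subseteq> {v \<in> vecs N. \<psi> v = v}"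
  proof (rule image_subsetI)
    fix u assume u: "u \<in> \<Theta>"
    have "orbit_sum {..<t} u \<in> vecs N"
      using orbit_sum_in_S[OF u, of "{..<t}"] ksub_S[of "{..<t}"] by (auto simp: ksub_iff)
    then show "orbit_sum {..<t} u \<in> {v \<in> vecs N. \<psi> v = v}"
      using \<psi>_orbit_sum[OF \<Theta>_vecs[OF u]] by simp
  qed
  show "{v \<in> vecs N. \<psi> v = v} \<subseteq> orbit_sum {..<t} ` \<Theta>"
  proof
    fix v assume v: "v \<in> {v \<in> vecs N. \<psi> v = v}"
    then have "v \<in> S {..<t}" using span_\<Theta> by (simp add: S_def kspan_eq_span)
    then obtain x where x: "x \<in> PiE {..<t} Th" "v = (\<Sum>j<t. x j)"
      unfolding S_eq[OF finite_lessThan] by blast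
    obtain s where s: "t = Suc s" using t_ge by (cases t) auto
    have xTh: "x j \<in> Th j" if "j < t" for j using x(1) that by auto
    have Th_vecs: "Th j \<subseteq> vecs N" for j using ksub_Th by (simp add: ksub_iff)
    have \<psi>_Th: "\<psi> w \<in> Th (Suc j)" if "w \<in> Th j" for w j using that by (auto simp: Th_def)
    \<comment> \<open>The wrap-around: the image of the last conjugate is the first one.\<close>
    have "Th t = \<Theta>"
      using \<psi>_period \<Theta>_vecs by (force simp: Th_def)
    then have Th_t: "Th t = Th 0" by (simp add: Th_def)
    \<comment> \<open>The components of \<open>\<psi> v\<close>, indexed by the conjugate in which
      they lie; the last component \<open>x s\<close>, with \<open>s = t - 1\<close>, moves to index
      0.\<close>
    define y where "y j = (case j of 0 \<Rightarrow> \<psi> (x s) | Suc i \<Rightarrow> \<psi> (x i))" for j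
    have "(\<Sum>j<t. y j) = \<psi> (x s) + (\<Sum>j<s. \<psi> (x j))"
      by (simp only: s sum.lessThan_Suc_shift y_def nat.case)
    also have "\<dots> = (\<Sum>j<t. \<psi> (x j))"
      by (simp add: s add.commute)
    also have "\<dots> = \<psi> v"
      unfolding x(2) using xTh Th_vecs
      by (intro semilinear_on_sum[OF semilin subspace_vecs, symmetric]) blast
    finally have sum_y: "(\<Sum>j<t. x j) = (\<Sum>j<t. y j)" using v x(2) by simp
    have yTh: "y j \<in> Th j" if j: "j < t" for j
    proof (cases j)
      case 0
      have "\<psi> (x s) \<in> Th t" using \<psi>_Th[OF xTh[of s]] by (simp add: s)
      then show ?thesis unfolding Th_t by (simp add: 0 y_def)
    next
      case (Suc i)
      have "\<psi> (x i) \<in> Th j" using \<psi>_Th[OF xTh[of i]] j by (simp add: Suc)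
      then show ?thesis by (simp add: Suc y_def)
    qed
    have step: "x j = y j" if "j < t" for j
      by (rule sum_unique[OF xTh yTh sum_y that])
    have orbit: "x j = (\<psi> ^^ j) (x 0)" if "j < t" for j
      using that
    proof (induction j)
      case (Suc j)
      then show ?case using step[of "Suc j"] by (simp add: y_def)
    qed simp
    then have "v = orbit_sum {..<t} (x 0)"
      unfolding x(2) orbit_sum_def by (intro sum.cong refl orbit) simp
    moreover have "x 0 \<in> \<Theta>" using xTh[of 0] t_ge by (simp add: Th_def)
    ultimately show "v \<in> orbit_sum {..<t} ` \<Theta>" by blast
  qed
qed

lemma inj_orbit_sum: "inj_on (orbit_sum {..<t}) \<Theta>"
proof (rule inj_onI)
  fix u v assume uv: "u \<in> \<Theta>" "v \<in> \<Theta>" "orbit_sum {..<t} u = orbit_sum {..<t} v"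
  have "(\<psi> ^^ 0) u = (\<psi> ^^ 0) v"
    by (rule sum_unique[where x = "\<lambda>j. (\<psi> ^^ j) u" and y = "\<lambda>j. (\<psi> ^^ j) v"])
      (use uv t_ge in \<open>auto simp: Th_def orbit_sum_def\<close>)
  then show "u = v" by simp
qed

text \<open>The fixed vectors number \<open>card (Fq q) ^ N\<close> by the coordinate count, and
  \<open>card \<Theta> = (q ^ t) ^ n = q ^ N\<close> as orbit sums. Comparing bases gives the size
  of \<open>Fq q\<close>.\<close>

lemma card_Fq: "card (Fq q :: 'k set) = q"
proof -
  have "card (Fq q :: 'k set) ^ N = card \<Theta>"
    unfolding card_fixed[symmetric] fixed_vectors by (rule card_image[OF inj_orbit_sum])
  also have "\<dots> = q ^ N"
    using card_Th[of 0] by (simp add: Th_def card_K N_eq power_mult)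
  finally show ?thesis
    using n_ge t_ge by (subst (asm) power_eq_iff_eq_base) (auto simp: N_eq)
qed

end

section \<open>Projection of the subgeometry from \<open>\<Gamma>\<close> onto
  \<open>\<Lambda>\<close>\<close>

locale director_pair = director_frame +
  fixes i1 i2 :: nat
  assumes i1: "i1 < t" and i2: "i2 < t" and gcd: "gcd (int i2 - int i1) (int t) = 1"
begin

text \<open>Congruent to \<open>i2 - i1\<close> modulo \<open>t\<close>; adding \<open>t\<close>
  keeps it a positive natural number.\<close>

definition "m = i2 + t - i1"
definition "\<Gamma> = S ({0..<t} - {i1, i2})"

text \<open>Equal indices would make the greatest common divisor \<open>t\<close>, which is at least
  3.\<close>

lemma neq: "i1 \<noteq> i2"
  using gcd t_ge by auto

lemma m_pos: "m \<noteq> 0"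
  using i1 by (simp add: m_def)

lemma coprime_m: "coprime m t"
proof -
  have "int m = (int i2 - int i1) + int t" using i1 by (simp add: m_def of_nat_diff)
  then have "gcd (int m) (int t) = 1" using gcd by (simp only: gcd_add1)
  then have "gcd m t = 1" by (simp only: gcd_int_int_eq of_nat_eq_1_iff)
  then show ?thesis by (simp only: coprime_iff_gcd_eq_1)
qed

lemma funpow_m: "u \<in> vecs N \<Longrightarrow> (\<psi> ^^ m) ((\<psi> ^^ i1) u) = (\<psi> ^^ i2) u"
proof -
  assume u: "u \<in> vecs N"
  have "(\<psi> ^^ m) ((\<psi> ^^ i1) u) = (\<psi> ^^ (m + i1)) u" by (simp add: funpow_add)
  also have "m + i1 = i2 + t" using i1 by (simp add: m_def)
  also have "(\<psi> ^^ (i2 + t)) u = (\<psi> ^^ i2) u" using \<psi>_period[OF u] by (simp add: funpow_add)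
  finally show ?thesis .
qed

lemma semilinear_pair: "semilinear_pair q t n N (Th i1) (Th i2) (\<psi> ^^ m) (\<sigma> ^^ m)"
proof
  show "2 \<le> n" "2 \<le> t" using n_ge t_ge by auto
  show "CARD('a) = q ^ t" "card (Fq q :: 'a set) = q" by (rule card_K, rule card_Fq)
  show "ksub N (Th i1)" "ksub N (Th i2)" "kdim (Th i1) = n" "kdim (Th i2) = n"
    by (rule ksub_Th kdim_Th)+
  have "S {i} = Th i" for i
    using vs.span_eq_iff[of "Th i"] subspace_Th by (simp add: S_def kspan_eq_span)
  then show "Th i1 \<inter> Th i2 = {0}"
    using S_disjoint[of "{i1}" "{i2}"] i1 i2 neq by simp
  have "(\<psi> ^^ m) ` Th i1 = Th i2"
    unfolding Th_def image_image by (intro image_cong refl) (simp add: funpow_m \<Theta>_vecs)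
  then show "semilinear_on (Th i1) (Th i2) (\<psi> ^^ m) (\<sigma> ^^ m)"
    using semilinear_on_subset[OF semilin_funpow, of "Th i1" m] ksub_Th by (simp add: ksub_iff)
  \<comment> \<open>Since \<open>m\<close> is prime to the period \<open>t\<close>, passing to the
    power \<open>m\<close> of \<open>\<sigma>\<close> does not enlarge the fixed field.\<close>
  have "\<sigma> x = x" if "(\<sigma> ^^ m) x = x" for x
    by (rule funpow_coprime_fixed[OF that \<sigma>_period coprime_m m_pos])
  then show "{x. (\<sigma> ^^ m) x = x} = Fq q"
    unfolding fixed[symmetric] using funpow_fixed[of \<sigma>] by blast
qed

sublocale pair: semilinear_pair q t n N "Th i1" "Th i2" "\<psi> ^^ m" "\<sigma> ^^ m"
  by (rule semilinear_pair)

lemma \<Lambda>_eq_S: "pair.\<Lambda> = S {i1, i2}"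
  by (simp add: pair.\<Lambda>_def S_def)

lemma subset_lessThan: "{0..<t} - {i1, i2} \<subseteq> {..<t}" "{i1, i2} \<subseteq> {..<t}"
  using i1 i2 by auto

lemma kdim_\<Gamma>: "kdim \<Gamma> = n * (t - 2)"
proof -
  have "card ({0..<t} - {i1, i2}) = t - 2"
    using i1 i2 neq by (subst card_Diff_subset) auto
  then show ?thesis using kdim_S[OF subset_lessThan(1)] by (simp add: \<Gamma>_def)
qed

lemma kdim_\<Lambda>: "kdim pair.\<Lambda> = 2 * n"
  using kdim_S[OF subset_lessThan(2)] neq by (simp add: \<Lambda>_eq_S)

lemma \<Gamma>_\<Lambda>_disjoint: "\<Gamma> \<inter> pair.\<Lambda> = {0}"
  unfolding \<Gamma>_def \<Lambda>_eq_S by (rule S_disjoint[OF subset_lessThan]) auto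

lemma orbit_sum_split:
  assumes u: "u \<in> \<Theta>"
  shows "orbit_sum {..<t} u = orbit_sum ({0..<t} - {i1, i2}) u + ((\<psi> ^^ i1) u + (\<psi> ^^ m) ((\<psi> ^^ i1) u))"
proof -
  have "orbit_sum {..<t} u = orbit_sum ({..<t} - {i1, i2}) u + orbit_sum {i1, i2} u"
    unfolding orbit_sum_def using subset_lessThan(2) by (intro sum.subset_diff) auto
  then show ?thesis
    using neq funpow_m[OF \<Theta>_vecs[OF u]] by (simp add: orbit_sum_def lessThan_atLeast0)
qed

text \<open>The summands with indices other than \<open>i1\<close> and \<open>i2\<close> lie in
  \<open>\<Gamma>\<close> and disappear; the other two form a vector of the graph.\<close>

lemma project_orbit_sum:
  assumes u: "u \<in> \<Theta>"
  shows "kspan (\<Gamma> \<union> kspan {orbit_sum {..<t} u}) \<inter> pair.\<Lambda>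
    = kspan {(\<psi> ^^ i1) u + (\<psi> ^^ m) ((\<psi> ^^ i1) u)}"
  unfolding orbit_sum_split[OF u] kspan_eq_span
proof (rule span_projection)
  show "vs.subspace \<Gamma>" "vs.subspace pair.\<Lambda>" "\<Gamma> \<inter> pair.\<Lambda> = {0}"
    using \<Gamma>_\<Lambda>_disjoint by (simp_all add: \<Gamma>_def \<Lambda>_eq_S subspace_S)
  show "orbit_sum ({0..<t} - {i1, i2}) u \<in> \<Gamma>"
    unfolding \<Gamma>_def by (rule orbit_sum_in_S[OF u])
  have "(\<psi> ^^ i1) u \<in> Th i1" using u by (auto simp: Th_def)
  then show "(\<psi> ^^ i1) u + (\<psi> ^^ m) ((\<psi> ^^ i1) u) \<in> pair.\<Lambda>"
    using pair.U_subset by (auto simp: pair.U_def)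
qed

lemma orbit_sum_eq_0_iff: "u \<in> \<Theta> \<Longrightarrow> orbit_sum {..<t} u = 0 \<longleftrightarrow> u = 0"
proof -
  assume u: "u \<in> \<Theta>"
  have "0 \<in> \<Theta>" using vs.subspace_0[of \<Theta>] ksub_\<Theta> by (simp add: ksub_iff)
  moreover have "orbit_sum {..<t} 0 = 0" by (simp add: orbit_sum_def \<psi>_zero)
  ultimately show ?thesis using u inj_orbit_sum by (metis inj_onD)
qed

text \<open>The subgeometry in terms of vectors fixed by \<open>\<psi>\<close>; the coordinate frame
  below identifies it with the fixed points of the given collineation.\<close>

definition "\<Sigma> = {kspan {v} | v. v \<in> vecs N \<and> v \<noteq> 0 \<and> \<psi> v = v}"

lemma \<Sigma>_eq: "\<Sigma> = {kspan {orbit_sum {..<t} u} | u. u \<in> \<Theta> \<and> u \<noteq> 0}"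
proof -
  have "v \<in> vecs N \<and> v \<noteq> 0 \<and> \<psi> v = v \<longleftrightarrow> (\<exists>u\<in>\<Theta>. u \<noteq> 0 \<and> v = orbit_sum {..<t} u)" for v
  proof -
    have "v \<in> vecs N \<and> \<psi> v = v \<longleftrightarrow> v \<in> orbit_sum {..<t} ` \<Theta>"
      unfolding fixed_vectors[symmetric] by simp
    then show ?thesis using orbit_sum_eq_0_iff by auto
  qed
  then show ?thesis unfolding \<Sigma>_def by auto
qed

theorem projection_eq: "proj \<Gamma> pair.\<Lambda> \<Sigma> = linset pair.U"
proof -
  have "proj \<Gamma> pair.\<Lambda> \<Sigma> = {kspan (\<Gamma> \<union> kspan {orbit_sum {..<t} u}) \<inter> pair.\<Lambda> | u. u \<in> \<Theta> \<and> u \<noteq> 0}"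
    unfolding proj_def \<Sigma>_eq by blast
  also have "\<dots> = {kspan {(\<psi> ^^ i1) u + (\<psi> ^^ m) ((\<psi> ^^ i1) u)} | u. u \<in> \<Theta> \<and> u \<noteq> 0}"
    using project_orbit_sum by (intro Collect_cong) metis
  also have "\<dots> = {kspan {x + (\<psi> ^^ m) x} | x. x \<in> Th i1 \<and> x \<noteq> 0}"
    unfolding Th_def using \<psi>_eq_0_iff[OF \<Theta>_vecs] by blast
  finally show ?thesis unfolding pair.linset_U .
qed

text \<open>The generator of a subgeometry point has a nonzero \<open>\<Lambda>\<close> component,
  namely a graph vector. A multiple lying in \<open>\<Gamma>\<close> must have zero
  \<open>\<Lambda>\<close> component and hence vanish.\<close>

lemma \<Sigma>_\<Gamma>_disjoint: "P \<in> \<Sigma> \<Longrightarrow> P \<inter> \<Gamma> = {0}"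
proof -
  assume "P \<in> \<Sigma>"
  then obtain u where u: "u \<in> \<Theta>" "u \<noteq> 0" "P = vs.span {orbit_sum {..<t} u}"
    by (auto simp: \<Sigma>_eq kspan_eq_span)
  let ?x = "orbit_sum ({0..<t} - {i1, i2}) u" and ?y = "(\<psi> ^^ i1) u + (\<psi> ^^ m) ((\<psi> ^^ i1) u)"
  have x: "?x \<in> \<Gamma>" unfolding \<Gamma>_def by (rule orbit_sum_in_S[OF u(1)])
  have Th: "(\<psi> ^^ i1) u \<in> Th i1" using u by (auto simp: Th_def)
  then have y: "?y \<in> pair.\<Lambda>" using pair.U_subset by (auto simp: pair.U_def)
  have y0: "?y \<noteq> 0"
    using pair.graph_eq_0_iff[OF Th] \<psi>_eq_0_iff[OF \<Theta>_vecs[OF u(1)]] u(2) by simp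
  have sub: "vs.subspace \<Gamma>" "vs.subspace pair.\<Lambda>"
    by (simp_all add: \<Gamma>_def \<Lambda>_eq_S subspace_S)
  have "c = 0" if c: "sc c (?x + ?y) \<in> \<Gamma>" for c
  proof -
    have "sc c (?x + ?y) - sc c ?x \<in> \<Gamma>"
      by (rule vs.subspace_diff[OF sub(1) c vs.subspace_scale[OF sub(1) x]])
    then have "sc c ?y \<in> \<Gamma>" by (simp only: vs.scale_right_distrib add_diff_cancel_left')
    moreover have "sc c ?y \<in> pair.\<Lambda>" using y by (intro vs.subspace_scale[OF sub(2)])
    ultimately have "sc c ?y = 0" using \<Gamma>_\<Lambda>_disjoint by blast
    then show ?thesis using y0 by simp
  qed
  then have "v = 0" if "v \<in> P" "v \<in> \<Gamma>" for v
    using that unfolding u(3) vs.span_singleton orbit_sum_split[OF u(1)] by auto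
  moreover have "0 \<in> P" "0 \<in> \<Gamma>"
    using vs.subspace_0[OF sub(1)] vs.span_zero by (auto simp: u(3))
  ultimately show ?thesis by blast
qed

end

section \<open>Coordinates in the subgeometry\<close>

text \<open>The subgeometry with a chosen basis \<open>b\<close>. Two coordinates, available by
  \<open>N_ge\<close>, are enough to test a scalar against the reference value 1.\<close>

locale canonical_frame =
  fixes q t N :: nat and \<phi> :: "'k::{finite,field} vect \<Rightarrow> 'k vect"
    and \<sigma> :: "'k \<Rightarrow> 'k" and b :: "nat \<Rightarrow> 'k vect"
  assumes q_pos: "0 < q" and N_ge: "2 \<le> N"
    and semilin: "semilinear_on (vecs N) (vecs N) \<phi> \<sigma>"
    and order: "coll_order N \<phi> t"
    and b_vecs: "i < N \<Longrightarrow> b i \<in> vecs N"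
    and b_indep: "(\<Sum>i<N. sc (c i) (b i)) = 0 \<Longrightarrow> i < N \<Longrightarrow> c i = 0"
    and b_span: "kspan (b ` {..<N}) = vecs N"
    and fixpts: "fixpts N \<phi> =
      {kspan {\<Sum>i<N. sc (a i) (b i)} | a. (\<forall>i<N. a i \<in> Fq q) \<and> (\<exists>i<N. a i \<noteq> 0)}"
begin

definition "comb a = (\<Sum>i<N. sc (a i) (b i))"

lemma comb_vecs: "comb a \<in> vecs N"
  unfolding comb_def
  by (intro vs.subspace_sum[OF subspace_vecs] vs.subspace_scale[OF subspace_vecs] b_vecs) simp

lemma comb_scale: "sc c (comb a) = comb (\<lambda>i. c * a i)"
  by (simp add: comb_def vs.scale_sum_right)

lemma comb_cong: "(\<And>i. i < N \<Longrightarrow> a i = a' i) \<Longrightarrow> comb a = comb a'"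
  unfolding comb_def by (intro sum.cong refl) simp

lemma comb_inj:
  assumes "comb a = comb a'" "i < N"
  shows "a i = a' i"
proof -
  have "(\<Sum>i<N. sc (a i - a' i) (b i)) = comb a - comb a'"
    by (simp only: comb_def vs.scale_left_diff_distrib sum_subtractf)
  also have "\<dots> = 0" by (simp only: assms(1) diff_self)
  finally have "a i - a' i = 0" by (rule b_indep[OF _ assms(2)])
  then show ?thesis by simp
qed

lemma comb_zero: "comb (\<lambda>_. 0) = 0"
  by (simp add: comb_def)

lemma comb_eq_0: "comb a = 0 \<Longrightarrow> i < N \<Longrightarrow> a i = 0"
  using comb_inj[of a "\<lambda>_. 0"] comb_zero by simp

lemma comb_delta:
  assumes "i < N"
  shows "comb (\<lambda>j. if j = i then 1 else 0) = b i"
proof -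
  have "comb (\<lambda>j. if j = i then 1 else 0) = (\<Sum>j<N. if j = i then b j else 0)"
    unfolding comb_def by (intro sum.cong) auto
  also have "\<dots> = b i"
    using assms by (simp only: sum.delta finite_lessThan lessThan_iff if_True)
  finally show ?thesis .
qed

lemma vecs_eq_comb:
  assumes "v \<in> vecs N"
  obtains a where "v = comb a"
proof -
  have "vs.span (b ` {..<N}) \<subseteq> range comb"
  proof (rule vs.span_minimal)
    show "b ` {..<N} \<subseteq> range comb"
      using comb_delta by (metis image_subsetI lessThan_iff rangeI)
    show "vs.subspace (range comb)"
    proof (rule vs.subspaceI)
      show "0 \<in> range comb" using comb_zero by (metis rangeI)
    next
      fix x y assume "x \<in> range comb" "y \<in> range comb"
      then obtain a c where "x = comb a" "y = comb c" by blast
      then have "x + y = comb (\<lambda>i. a i + c i)"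
        by (simp only: comb_def vs.scale_left_distrib sum.distrib)
      then show "x + y \<in> range comb" by simp
    next
      fix c x assume "x \<in> range comb"
      then obtain a where "x = comb a" by blast
      then show "sc c x \<in> range comb" using comb_scale by simp
    qed
  qed
  then show ?thesis using that assms b_span unfolding kspan_eq_span by blast
qed

lemma image_comb: "\<phi> (comb a) = (\<Sum>i<N. sc (\<sigma> (a i)) (\<phi> (b i)))"
proof -
  have "\<phi> (comb a) = (\<Sum>i<N. \<phi> (sc (a i) (b i)))"
    unfolding comb_def by (intro semilinear_on_sum[OF semilin subspace_vecs]
        vs.subspace_scale[OF subspace_vecs] b_vecs) simp
  also have "\<dots> = (\<Sum>i<N. sc (\<sigma> (a i)) (\<phi> (b i)))"
    by (intro sum.cong refl semilinear_on_scale[OF semilin] b_vecs) simp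
  finally show ?thesis .
qed

lemma aut: "field_aut \<sigma>"
  by (rule semilinear_on_aut[OF semilin])

lemma zero_one_Fq: "0 \<in> Fq q" "1 \<in> Fq q"
  using q_pos by (simp_all add: Fq_def)

lemma comb_fixpts:
  assumes "\<And>i. i < N \<Longrightarrow> a i \<in> Fq q" "i < N" "a i \<noteq> 0"
  shows "vs.span {comb a} \<in> fixpts N \<phi>"
  unfolding fixpts comb_def kspan_eq_span using assms by blast

lemma fixpt_eigenvector:
  assumes "vs.span {v} \<in> fixpts N \<phi>"
  obtains c where "\<phi> v = sc c v"
proof -
  have "\<phi> v \<in> vs.span {v}"
    using assms vs.span_base[of v "{v}"] unfolding fixpts_def by blast
  then show ?thesis using that unfolding vs.span_singleton by blast
qed

text \<open>Comparing the eigenvalue of the sum of the basis vectors with those of the basis vectors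
  shows that all of them agree.\<close>

lemma common_eigenvalue: "\<exists>\<mu>. \<mu> \<noteq> 0 \<and> (\<forall>i<N. \<phi> (b i) = sc \<mu> (b i))"
proof -
  have N0: "0 < N" using N_ge by simp
  have "\<exists>c. \<phi> (b i) = sc c (b i)" if "i < N" for i
    using fixpt_eigenvector[of "b i"] comb_fixpts[of "\<lambda>j. if j = i then 1 else 0" i] that zero_one_Fq
    by (metis comb_delta[OF that] zero_neq_one)
  then obtain \<nu> where \<nu>: "\<And>i. i < N \<Longrightarrow> \<phi> (b i) = sc (\<nu> i) (b i)" by metis
  obtain \<mu> where \<mu>: "\<phi> (comb (\<lambda>_. 1)) = sc \<mu> (comb (\<lambda>_. 1))"
    using fixpt_eigenvector comb_fixpts[of "\<lambda>_. 1" 0] N0 zero_one_Fq by (metis zero_neq_one)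
  have "\<phi> (comb (\<lambda>_. 1)) = comb \<nu>"
    unfolding image_comb comb_def[of \<nu>]
    by (intro sum.cong refl) (simp add: field_aut_1[OF aut] \<nu>)
  then have "comb \<nu> = comb (\<lambda>_. \<mu>)" using \<mu> by (simp add: comb_scale)
  then have eq: "\<nu> i = \<mu>" if "i < N" for i using comb_inj that by blast
  have "\<mu> \<noteq> 0"
  proof
    assume "\<mu> = 0"
    then have "\<phi> (b 0) = 0" using \<nu>[OF N0] eq[OF N0] by simp
    then have "b 0 = 0"
      using semilinear_on_inj[OF semilin] semilinear_on_zero[OF semilin vs.subspace_0[OF subspace_vecs]]
        b_vecs[OF N0] vs.subspace_0[OF subspace_vecs] by (metis inj_onD)
    then have "comb (\<lambda>j. if j = 0 then 1 else 0) = 0" using comb_delta[OF N0] by simp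
    then show False using comb_eq_0[OF _ N0] by fastforce
  qed
  then show ?thesis using \<nu> eq by auto
qed

section \<open>The normalised map \<open>\<psi>\<close>, its period and its fixed vectors\<close>

definition "\<mu> = (SOME \<mu>. \<mu> \<noteq> 0 \<and> (\<forall>i<N. \<phi> (b i) = sc \<mu> (b i)))"

lemma \<mu>_nz: "\<mu> \<noteq> 0" and \<phi>_b: "i < N \<Longrightarrow> \<phi> (b i) = sc \<mu> (b i)"
  using someI_ex[OF common_eigenvalue] unfolding \<mu>_def by auto

text \<open>This multiple of \<open>\<phi>\<close> fixes every \<open>b i\<close>.\<close>

definition "\<psi> v = sc (inverse \<mu>) (\<phi> v)"

lemma \<phi>_eq: "\<phi> v = sc \<mu> (\<psi> v)"
  using \<mu>_nz by (simp add: \<psi>_def)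

lemma \<psi>_comb: "\<psi> (comb a) = comb (\<lambda>i. \<sigma> (a i))"
proof -
  have "\<phi> (comb a) = sc \<mu> (comb (\<lambda>i. \<sigma> (a i)))"
    unfolding image_comb comb_scale unfolding comb_def
    by (intro sum.cong refl) (simp add: \<phi>_b mult.commute)
  then show ?thesis using \<mu>_nz by (simp add: \<psi>_def)
qed

lemma semilin_\<psi>: "semilinear_on (vecs N) (vecs N) \<psi> \<sigma>"
proof -
  have \<phi>_vecs: "\<phi> v \<in> vecs N" if "v \<in> vecs N" for v using semilinear_on_image[OF semilin] that by blast
  have "inj_on \<psi> (vecs N)"
    using semilinear_on_inj[OF semilin] \<mu>_nz by (auto simp: inj_on_def \<psi>_def)
  moreover have "\<psi> ` vecs N \<subseteq> vecs N"
    using \<phi>_vecs vs.subspace_scale[OF subspace_vecs] by (auto simp: \<psi>_def)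
  ultimately have "bij_betw \<psi> (vecs N) (vecs N)"
    by (simp add: bij_betw_def endo_inj_surj finite_vecs)
  moreover have "\<psi> (u + v) = \<psi> u + \<psi> v" if "u \<in> vecs N" "v \<in> vecs N" for u v
    unfolding \<psi>_def semilinear_on_add[OF semilin that] by (rule vs.scale_right_distrib)
  moreover have "\<psi> (sc c v) = sc (\<sigma> c) (\<psi> v)" if "v \<in> vecs N" for c v
    unfolding \<psi>_def semilinear_on_scale[OF semilin that] by (rule vs.scale_left_commute)
  ultimately show ?thesis using aut by (simp only: semilinear_on_def) blast
qed

lemma funpow_\<psi>_comb: "(\<psi> ^^ k) (comb a) = comb (\<lambda>i. (\<sigma> ^^ k) (a i))"
  by (induction k) (simp_all add: \<psi>_comb)

lemma \<psi>_vecs: "v \<in> vecs N \<Longrightarrow> (\<psi> ^^ k) v \<in> vecs N"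
  using semilinear_on_image[OF semilinear_on_funpow[OF semilin_\<psi>], of k] by blast

text \<open>What matters is that one scalar serves all \<open>v\<close>; each further application
  changes it from \<open>c\<close> to \<open>\<mu> * \<sigma> c\<close>.\<close>

lemma funpow_\<phi>: "\<exists>c. c \<noteq> 0 \<and> (\<forall>v\<in>vecs N. (\<phi> ^^ k) v = sc c ((\<psi> ^^ k) v))"
proof (induction k)
  case 0
  show ?case by (rule exI[of _ 1]) simp
next
  case (Suc k)
  then obtain c where c: "c \<noteq> 0" "\<And>v. v \<in> vecs N \<Longrightarrow> (\<phi> ^^ k) v = sc c ((\<psi> ^^ k) v)" by blast
  have "(\<phi> ^^ Suc k) v = sc (\<mu> * \<sigma> c) ((\<psi> ^^ Suc k) v)" if v: "v \<in> vecs N" for v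
  proof -
    have "(\<phi> ^^ Suc k) v = \<phi> (sc c ((\<psi> ^^ k) v))" by (simp add: c(2)[OF v])
    also have "\<dots> = sc (\<sigma> c) (\<phi> ((\<psi> ^^ k) v))"
      by (rule semilinear_on_scale[OF semilin \<psi>_vecs[OF v]])
    also have "\<dots> = sc (\<mu> * \<sigma> c) ((\<psi> ^^ Suc k) v)"
      by (simp add: \<phi>_eq mult.commute)
    finally show ?thesis .
  qed
  moreover have "\<sigma> c \<noteq> 0"
    using c(1) aut field_aut_0[OF aut] unfolding field_aut_def bij_def inj_def by metis
  ultimately show ?case using \<mu>_nz by (intro exI[of _ "\<mu> * \<sigma> c"]) simp
qed

text \<open>The two powers differ by a nonzero scalar, which does not affect a subspace. So
  conjugates of points and of director spaces may be formed with either map.\<close>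

lemma image_\<phi>_eq_\<psi>:
  assumes W: "ksub N W"
  shows "(\<phi> ^^ k) ` W = (\<psi> ^^ k) ` W"
proof -
  obtain c where c: "c \<noteq> 0" "\<And>v. v \<in> vecs N \<Longrightarrow> (\<phi> ^^ k) v = sc c ((\<psi> ^^ k) v)"
    using funpow_\<phi> by blast
  have sub: "vs.subspace ((\<psi> ^^ k) ` W)"
    using ksub_semilinear_image[OF semilinear_on_funpow[OF semilin_\<psi>] W] by (simp add: ksub_iff)
  have Wv: "v \<in> vecs N" if "v \<in> W" for v using W that by (auto simp: ksub_iff)
  have "(\<phi> ^^ k) ` W = sc c ` (\<psi> ^^ k) ` W"
    unfolding image_image by (rule image_cong[OF refl c(2)[OF Wv]])
  also have "\<dots> = (\<psi> ^^ k) ` W"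
  proof
    show "sc c ` (\<psi> ^^ k) ` W \<subseteq> (\<psi> ^^ k) ` W"
      using vs.subspace_scale[OF sub] by blast
    show "(\<psi> ^^ k) ` W \<subseteq> sc c ` (\<psi> ^^ k) ` W"
    proof
      fix x assume "x \<in> (\<psi> ^^ k) ` W"
      then have "sc (inverse c) x \<in> (\<psi> ^^ k) ` W" by (rule vs.subspace_scale[OF sub])
      moreover have "x = sc c (sc (inverse c) x)" using c(1) by simp
      ultimately show "x \<in> sc c ` (\<psi> ^^ k) ` W" by blast
    qed
  qed
  finally show ?thesis .
qed

lemma ksub_span_singleton: "v \<in> vecs N \<Longrightarrow> ksub N (vs.span {v})"
  by (simp add: ksub_span)

text \<open>The coordinate \<open>1\<close> of the test vector pins down the eigenvalue.\<close>

lemma test_vector: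
  assumes "\<tau> 1 = 1" "comb (\<lambda>i. \<tau> (if i = 0 then 1 else c)) = sc k (comb (\<lambda>i. if i = 0 then 1 else d))"
  shows "k = 1" "\<tau> c = d"
proof -
  have *: "\<tau> (if i = 0 then 1 else c) = k * (if i = 0 then 1 else d)" if "i < N" for i
    using comb_inj[OF assms(2)[unfolded comb_scale] that] .
  show k: "k = 1" using *[of 0] N_ge assms(1) by simp
  show "\<tau> c = d" using *[of 1] N_ge k by simp
qed

lemma test_vector_nz: "comb (\<lambda>i. if i = 0 then 1 else c) \<noteq> 0"
  using comb_eq_0[of "\<lambda>i. if i = 0 then 1 else c" 0] N_ge by auto

text \<open>The order of the collineation speaks of points, so it gives invariance only up to a
  factor. For the vector with coordinates 1 and \<open>c\<close> the entry 1 forces that factor to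
  be 1.\<close>

lemma \<sigma>_period: "(\<sigma> ^^ t) c = c"
proof -
  define v where "v = comb (\<lambda>i. if i = 0 then 1 else c)"
  have v: "v \<in> vecs N" "v \<noteq> 0" unfolding v_def by (rule comb_vecs, rule test_vector_nz)
  then have "vs.span {v} \<in> points N" unfolding points_def kspan_eq_span by blast
  then have "(\<phi> ^^ t) ` vs.span {v} = vs.span {v}" using order by (simp add: coll_order_def)
  then have "(\<psi> ^^ t) ` vs.span {v} = vs.span {v}"
    by (simp only: image_\<phi>_eq_\<psi>[OF ksub_span_singleton[OF v(1)]])
  then have "(\<psi> ^^ t) v \<in> vs.span {v}" using vs.span_base[of v "{v}"] by blast
  then obtain k where "(\<psi> ^^ t) v = sc k v" unfolding vs.span_singleton by blast
  then have "comb (\<lambda>i. (\<sigma> ^^ t) (if i = 0 then 1 else c)) = sc k (comb (\<lambda>i. if i = 0 then 1 else c))"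
    unfolding v_def funpow_\<psi>_comb .
  then show ?thesis
    by (rule test_vector(2)[rotated]) (rule funpow_fixed[where f = \<sigma>, OF field_aut_1[OF aut]])
qed

lemma \<psi>_period: "v \<in> vecs N \<Longrightarrow> (\<psi> ^^ t) v = v"
  by (erule vecs_eq_comb) (simp add: funpow_\<psi>_comb \<sigma>_period)

lemma fixed_vector_fixpts:
  assumes v: "v \<in> vecs N" "v \<noteq> 0" "\<psi> v = v"
  shows "vs.span {v} \<in> fixpts N \<phi>"
proof -
  have "\<phi> ` vs.span {v} = \<psi> ` vs.span {v}"
    using image_\<phi>_eq_\<psi>[OF ksub_span_singleton[OF v(1)], of 1] by simp
  also have "\<dots> = range (\<lambda>c. sc (\<sigma> c) v)"
    unfolding vs.span_singleton image_image
    by (intro image_cong refl) (simp add: semilinear_on_scale[OF semilin_\<psi> v(1)] v(3))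
  also have "\<dots> = (\<lambda>c. sc c v) ` range \<sigma>" by (simp only: image_image)
  also have "\<dots> = vs.span {v}"
    using aut unfolding vs.span_singleton field_aut_def bij_def by simp
  finally show ?thesis
    using v(1,2) unfolding fixpts_def points_def kspan_eq_span by blast
qed

text \<open>For \<open>c\<close> in \<open>Fq q\<close> the test vector spans a subgeometry point
  and is therefore an eigenvector of \<open>\<phi>\<close>. Conversely, if \<open>\<sigma>\<close>
  fixes \<open>c\<close>, the test vector spans a fixed point, so it is proportional to a vector
  over \<open>Fq q\<close>, and \<open>c\<close> is a quotient of two of that vector's
  coordinates.\<close>

lemma fixed: "{x. \<sigma> x = x} = Fq q"
proof (intro set_eqI iffI)
  fix c :: 'k assume c: "c \<in> Fq q"
  let ?a = "\<lambda>i::nat. if i = 0 then 1 else c"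
  have "vs.span {comb ?a} \<in> fixpts N \<phi>"
    by (rule comb_fixpts[of _ 0]) (use c zero_one_Fq N_ge in auto)
  then obtain k where "\<phi> (comb ?a) = sc k (comb ?a)" by (rule fixpt_eigenvector)
  then have "\<psi> (comb ?a) = sc (inverse \<mu> * k) (comb ?a)" by (simp add: \<psi>_def)
  then have "comb (\<lambda>i. \<sigma> (?a i)) = sc (inverse \<mu> * k) (comb ?a)" by (simp only: \<psi>_comb)
  then have "\<sigma> c = c" by (rule test_vector(2)[where \<tau> = \<sigma>, OF field_aut_1[OF aut]])
  then show "c \<in> {x. \<sigma> x = x}" by simp
next
  fix c :: 'k assume "c \<in> {x. \<sigma> x = x}"
  then have c: "\<sigma> c = c" by simp
  let ?a = "\<lambda>i::nat. if i = 0 then 1 else c"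
  have "\<psi> (comb ?a) = comb ?a"
    unfolding \<psi>_comb by (rule comb_cong) (simp add: c field_aut_1[OF aut])
  then have "vs.span {comb ?a} \<in> fixpts N \<phi>"
    by (rule fixed_vector_fixpts[OF comb_vecs test_vector_nz])
  then obtain a where a: "\<And>i. i < N \<Longrightarrow> a i \<in> Fq q" "vs.span {comb ?a} = vs.span {comb a}"
    unfolding fixpts comb_def[symmetric] kspan_eq_span by blast
  have "comb ?a \<in> vs.span {comb a}" using vs.span_base[of "comb ?a" "{comb ?a}"] a(2) by simp
  then obtain k where "comb ?a = sc k (comb a)" unfolding vs.span_singleton by blast
  then have *: "?a i = k * a i" if "i < N" for i
    using comb_inj[of ?a _ i] that unfolding comb_scale by blast
  have "1 = k * a 0" "c = k * a 1" using *[of 0] *[of 1] N_ge by auto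
  \<comment> \<open>The first equation shows that neither \<open>k\<close> nor \<open>a 0\<close> is
    zero.\<close>
  then have "c = a 1 / a 0" by (metis div_by_1 mult_divide_mult_cancel_left_if mult_zero_left zero_neq_one)
  moreover have "a 0 \<in> Fq q" "a 1 \<in> Fq q" using a(1) N_ge by auto
  ultimately show "c \<in> Fq q" by (simp add: Fq_def power_divide)
qed

lemma \<psi>_comb_eq_iff: "\<psi> (comb a) = comb a \<longleftrightarrow> (\<forall>i<N. a i \<in> Fq q)"
proof -
  have "\<psi> (comb a) = comb a \<longleftrightarrow> (\<forall>i<N. \<sigma> (a i) = a i)"
    unfolding \<psi>_comb using comb_inj[of "\<lambda>i. \<sigma> (a i)" a] comb_cong[of "\<lambda>i. \<sigma> (a i)" a] by blast
  then show ?thesis using fixed by blast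
qed

lemma fixpts_eq: "fixpts N \<phi> = {kspan {v} | v. v \<in> vecs N \<and> v \<noteq> 0 \<and> \<psi> v = v}"
proof
  show "fixpts N \<phi> \<subseteq> {kspan {v} | v. v \<in> vecs N \<and> v \<noteq> 0 \<and> \<psi> v = v}"
  proof
    fix P assume "P \<in> fixpts N \<phi>"
    then obtain a where a: "P = kspan {comb a}" "\<forall>i<N. a i \<in> Fq q" "\<exists>i<N. a i \<noteq> 0"
      unfolding fixpts comb_def[symmetric] by blast
    have "comb a \<noteq> 0" using a(3) comb_eq_0 by blast
    moreover have "\<psi> (comb a) = comb a" using a(2) \<psi>_comb_eq_iff by simp
    ultimately show "P \<in> {kspan {v} | v. v \<in> vecs N \<and> v \<noteq> 0 \<and> \<psi> v = v}"
      using a(1) comb_vecs by blast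
  qed
  show "{kspan {v} | v. v \<in> vecs N \<and> v \<noteq> 0 \<and> \<psi> v = v} \<subseteq> fixpts N \<phi>"
    using fixed_vector_fixpts unfolding kspan_eq_span by blast
qed

lemma card_fixed: "card {v \<in> vecs N. \<psi> v = v} = card (Fq q :: 'k set) ^ N"
proof -
  have "{v \<in> vecs N. \<psi> v = v} = comb ` (PiE {..<N} (\<lambda>_. Fq q))"
  proof
    show "{v \<in> vecs N. \<psi> v = v} \<subseteq> comb ` (PiE {..<N} (\<lambda>_. Fq q))"
    proof
      fix v assume v: "v \<in> {v \<in> vecs N. \<psi> v = v}"
      then obtain a where a: "v = comb a" using vecs_eq_comb by blast
      then have "\<forall>i<N. a i \<in> Fq q" using v \<psi>_comb_eq_iff by simp
      then have "restrict a {..<N} \<in> PiE {..<N} (\<lambda>_. Fq q)" by auto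
      moreover have "v = comb (restrict a {..<N})" unfolding a by (rule comb_cong) simp
      ultimately show "v \<in> comb ` (PiE {..<N} (\<lambda>_. Fq q))" by blast
    qed
    show "comb ` (PiE {..<N} (\<lambda>_. Fq q)) \<subseteq> {v \<in> vecs N. \<psi> v = v}"
      using comb_vecs \<psi>_comb_eq_iff by auto
  qed
  moreover have "inj_on comb (PiE {..<N} (\<lambda>_. Fq q))"
  proof (rule inj_onI)
    fix a a' assume "a \<in> PiE {..<N} (\<lambda>_. Fq q)" "a' \<in> PiE {..<N} (\<lambda>_. Fq q)" "comb a = comb a'"
    then show "a = a'" using comb_inj by (intro PiE_ext) auto
  qed
  ultimately show ?thesis by (simp add: card_image card_PiE)
qed

section \<open>Director spaces with respect to \<open>\<psi>\<close>\<close>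

lemma director_cond_\<psi>:
  assumes "director_cond N t n \<phi> \<Theta>"
  shows "director_cond N t n \<psi> \<Theta>"
proof -
  have "ksub N \<Theta>" using assms by (simp add: director_cond_def)
  then show ?thesis using assms by (simp add: director_cond_def image_\<phi>_eq_\<psi>)
qed

text \<open>A director space is any conjugate of the space defining the spread, so the spanning
  condition has to be moved along the orbit. The shift by \<open>i\<close> only permutes the
  \<open>t\<close> conjugates cyclically.\<close>

lemma director_cond_shift:
  assumes dir: "director_cond N t n \<psi> \<Theta>" and i: "i < t"
  shows "director_cond N t n \<psi> ((\<psi> ^^ i) ` \<Theta>)"
proof -
  have \<Theta>: "ksub N \<Theta>" "kdim \<Theta> = n" and span: "vs.span (\<Union>j<t. (\<psi> ^^ j) ` \<Theta>) = vecs N"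
    using dir by (auto simp: director_cond_def kspan_eq_span)
  have ks: "ksub N ((\<psi> ^^ j) ` \<Theta>)" for j
    by (rule ksub_semilinear_image[OF semilinear_on_funpow[OF semilin_\<psi>] \<Theta>(1)])
  have shift: "(\<psi> ^^ j) ` (\<psi> ^^ i) ` \<Theta> = (\<psi> ^^ (j + i)) ` \<Theta>" for j
    by (simp add: image_image funpow_add)
  have "(\<Union>j<t. (\<psi> ^^ j) ` \<Theta>) \<subseteq> (\<Union>j<t. (\<psi> ^^ j) ` (\<psi> ^^ i) ` \<Theta>)"
  proof (rule UN_least)
    fix k assume k: "k \<in> {..<t}"
    have "\<exists>j<t. (\<psi> ^^ (j + i)) ` \<Theta> = (\<psi> ^^ k) ` \<Theta>"
    proof (cases "i \<le> k")
      case True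
      then show ?thesis using k by (intro exI[of _ "k - i"]) auto
    next
      case False
      have "(\<psi> ^^ (k + t)) ` \<Theta> = (\<psi> ^^ k) ` (\<psi> ^^ t) ` \<Theta>"
        by (simp add: image_image funpow_add)
      also have "(\<psi> ^^ t) ` \<Theta> = id ` \<Theta>"
        using \<psi>_period \<Theta>(1) by (intro image_cong refl) (auto simp: ksub_iff)
      \<comment> \<open>For \<open>k < i\<close> the index wraps around: \<open>k + t - i\<close> is
        below \<open>t\<close>, and the extra \<open>t\<close> applications of \<open>\<psi>\<close>
        cancel.\<close>
      finally show ?thesis using False k i by (intro exI[of _ "k + t - i"]) auto
    qed
    then show "(\<psi> ^^ k) ` \<Theta> \<subseteq> (\<Union>j<t. (\<psi> ^^ j) ` (\<psi> ^^ i) ` \<Theta>)"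
      unfolding shift by blast
  qed
  then have "vecs N \<subseteq> vs.span (\<Union>j<t. (\<psi> ^^ j) ` (\<psi> ^^ i) ` \<Theta>)"
    unfolding span[symmetric] by (rule vs.span_mono)
  moreover have "vs.span (\<Union>j<t. (\<psi> ^^ j) ` (\<psi> ^^ i) ` \<Theta>) \<subseteq> vecs N"
    using ks by (intro vs.span_minimal subspace_vecs) (auto simp: shift ksub_iff)
  moreover have "kdim ((\<psi> ^^ i) ` \<Theta>) = n"
    using kdim_semilinear_image[OF semilinear_on_funpow[OF semilin_\<psi>] \<Theta>(1), of i] \<Theta>(2) by simp
  ultimately show ?thesis
    using ks[of i] by (auto simp: director_cond_def kspan_eq_span)
qed

lemma director_space_imp_cond:
  assumes "director_space N t n \<phi> D \<Theta>"
  shows "director_cond N t n \<psi> \<Theta>"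
proof -
  obtain \<Theta>0 i where \<Theta>0: "director_cond N t n \<phi> \<Theta>0" "i < t" "\<Theta> = (\<phi> ^^ i) ` \<Theta>0"
    using assms by (auto simp: director_space_def)
  then have "\<Theta> = (\<psi> ^^ i) ` \<Theta>0" using image_\<phi>_eq_\<psi> by (simp add: director_cond_def)
  then show ?thesis using director_cond_shift[OF director_cond_\<psi>[OF \<Theta>0(1)] \<Theta>0(2)] by simp
qed

end

section \<open>The projection theorem, by passing from \<open>\<phi>\<close> to the normalised
  map\<close>

theorem theorem3p9:
  fixes q t n i1 i2 :: nat
    and \<phi> :: "'k::{finite,field} vect \<Rightarrow> 'k vect"
    and \<sigma> :: "'k \<Rightarrow> 'k"
    and D :: "'k vect set set set"
    and \<Theta> :: "'k vect set"
  assumes "n \<ge> 2" and "t \<ge> 3" and "card (UNIV :: 'k set) = q ^ t"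
    and "semilinear_on (vecs (t * n)) (vecs (t * n)) \<phi> \<sigma>"
    and "coll_order (t * n) \<phi> t"
    and "canonical_subgeometry q (t * n) (fixpts (t * n) \<phi>)"
    and "desarguesian_spread (t * n) t n \<phi> D"
    and "director_space (t * n) t n \<phi> D \<Theta>"
    and "i1 < t" and "i2 < t" and "gcd (int i2 - int i1) (int t) = 1"
  shows "let \<Sigma> = fixpts (t * n) \<phi>;
             \<Gamma> = kspan (\<Union>i\<in>{0..<t} - {i1, i2}. (\<phi> ^^ i) ` \<Theta>);
             \<Lambda> = kspan ((\<phi> ^^ i1) ` \<Theta> \<union> (\<phi> ^^ i2) ` \<Theta>);
             L = proj \<Gamma> \<Lambda> \<Sigma>
         in ksub (t * n) \<Gamma> \<and> kdim \<Gamma> = n * (t - 2) \<and>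
            (\<forall>P\<in>\<Sigma>. P \<inter> \<Gamma> = {0}) \<and> \<Gamma> \<inter> \<Lambda> = {0} \<and>
            ksub (t * n) \<Lambda> \<and> kdim \<Lambda> = 2 * n \<and>
            scattered_linear_set q \<Lambda> (t * n) L \<and>
            type_L_rho_f q (t * n) n \<Lambda> L \<and>
            pseudoregulus_type q (t * n) t n \<Lambda> L ((\<phi> ^^ i1) ` \<Theta>) ((\<phi> ^^ i2) ` \<Theta>)"
proof -
  \<comment> \<open>Needed for 0 to lie in \<open>Fq q\<close>, as \<open>0 ^ 0 = 1\<close>.\<close>
  have "q \<noteq> 0"
  proof
    assume "q = 0"
    then have "card (UNIV :: 'k set) = 0" using assms(2,3) by simp
    then show False by simp
  qed
  moreover have "2 \<le> t * n" using mult_le_mono[of 1 t 2 n] assms(1,2) by simp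
  moreover obtain b :: "nat \<Rightarrow> 'k vect" where
    "\<forall>i<t * n. b i \<in> vecs (t * n)"
    "\<forall>c. (\<Sum>i<t * n. sc (c i) (b i)) = 0 \<longrightarrow> (\<forall>i<t * n. c i = 0)"
    "kspan (b ` {..<t * n}) = vecs (t * n)"
    "fixpts (t * n) \<phi> = {kspan {\<Sum>i<t * n. sc (a i) (b i)} | a.
       (\<forall>i<t * n. a i \<in> Fq q) \<and> (\<exists>i<t * n. a i \<noteq> 0)}"
    using assms(6) unfolding canonical_subgeometry_def by (elim exE conjE) (rule that)
  ultimately interpret canonical_frame q t "t * n" \<phi> \<sigma> b
    using assms(4,5) by unfold_locales blast+
  have dir: "director_cond (t * n) t n \<psi> \<Theta>"
    by (rule director_space_imp_cond[OF assms(8)])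
  interpret dp: director_pair q t n "t * n" \<psi> \<sigma> \<Theta> i1 i2
    by unfold_locales
      (fact assms refl semilin_\<psi> \<psi>_period \<sigma>_period fixed card_fixed dir)+
  \<comment> \<open>The spaces in the statement are conjugates under \<open>\<phi>\<close>; as
    subspaces they coincide with those under \<open>\<psi>\<close>, for which the decomposition was
    carried out.\<close>
  have img: "(\<phi> ^^ i) ` \<Theta> = dp.Th i" for i
    unfolding dp.Th_def by (rule image_\<phi>_eq_\<psi>[OF dp.ksub_\<Theta>])
  have \<Sigma>: "fixpts (t * n) \<phi> = dp.\<Sigma>"
    unfolding fixpts_eq dp.\<Sigma>_def ..
  have \<Gamma>: "kspan (\<Union>i\<in>{0..<t} - {i1, i2}. dp.Th i) = dp.\<Gamma>"
    unfolding dp.\<Gamma>_def dp.S_def ..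
  have \<Lambda>: "kspan (dp.Th i1 \<union> dp.Th i2) = dp.pair.\<Lambda>"
    unfolding dp.pair.\<Lambda>_def ..
  show ?thesis
    unfolding Let_def img \<Gamma> \<Lambda> \<Sigma> dp.projection_eq
  proof (intro conjI ballI)
    show "ksub (t * n) dp.\<Gamma>" unfolding dp.\<Gamma>_def by (rule dp.ksub_S)
    show "P \<inter> dp.\<Gamma> = {0}" if "P \<in> dp.\<Sigma>" for P using that by (rule dp.\<Sigma>_\<Gamma>_disjoint)
  qed (fact dp.kdim_\<Gamma> dp.\<Gamma>_\<Lambda>_disjoint dp.pair.ksub_\<Lambda> dp.kdim_\<Lambda> dp.pair.scattered_linear_set_U
      dp.pair.type_L_rho_f_U dp.pair.pseudoregulus_type_U)+
qed

end
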